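(* Consider a two-phase composite with isotropic phases $\mathsf L_j=\sigma_j\otimes I_2+r_j\mathsf T$, $j=1,2$, where $\sigma_1,\sigma_2$ are not scalar multiples of one another and \[ |r_1-r_2|>\big|\sqrt{\det\sigma_1}-\sqrt{\det\sigma_2}\big| . \] Let $\lambda_1,\lambda_2$ be the two roots of $\det(\sigma_2-\lambda\sigma_1)=0$, $\Delta r=r_2-r_1$, and \[ S_1=\frac{\sigma_2-\lambda_1\sigma_1}{\lambda_2-\lambda_1},\qquad S_2=\frac{\sigma_2-\lambda_2\sigma_1}{\lambda_1-\lambda_2},\qquad Z_0=S_2R_\perp S_1-S_1R_\perp S_2, \] \[ A=\frac{\det\sigma_2-\det\sigma_1+r_1^2-r_2^2}{2\Delta r}, \] \[ B=\frac{\big((\Delta r)^2-(\sqrt{\det\sigma_1}-\sqrt{\det\sigma_2})^2\big)\big((\sqrt{\det\sigma_1}+\sqrt{\det\sigma_2})^2-(\Delta r)^2\big)}{4(\Delta r)^2}. \] Then the effective tensor satisfies \[ (\mathsf L^*+A\mathsf T)\,\mathsf T(Z_0\otimes R_\perp)\mathsf T\,(\mathsf L^*+A\mathsf T)+B\,Z_0\otimes R_\perp=0 . \]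
   Context: Let $R_\perp=\begin{pmatrix}0&-1\\1&0\end{pmatrix}$ and let $I_2$ be the $2\times2$ identity. Let $\mathcal T=\mathbb R^2\oplus\mathbb R^2$. Operators on $\mathcal T$ are written as $2\times2$ block matrices with real $2\times 2$ blocks, and $A\otimes B$ is the block matrix with blocks $A_{ij}B$. Put $\mathsf T=R_\perp\otimes R_\perp$. The phases $\mathsf L_j$ are assumed positive definite: $\sigma_j$ is a real symmetric positive definite $2\times2$ matrix and $r_j\in\mathbb R$ with $r_j^2<\det\sigma_j$. A two-phase composite is given by a measurable partition of the period cell $[0,1]^2=A_1\cup A_2$ (the microstructure) and the periodic tensor field $\mathsf L(x)=\mathsf L_j$ for $x\in A_j$. Its effective tensor $\mathsf L^*$ is defined by $\mathsf L^*E_0=\int_{[0,1]^2}\mathsf L(x)E(x)\,dx$ for $E_0\in\mathcal T$, where $E=E_0+(\nabla\varphi_1,\nabla\varphi_2)$ with $\varphi_1,\varphi_2\in H^1_{\rm per}$ is the unique such field for which both $\mathbb R^2$-components of $\mathsf L E$ are divergence-free. *)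

theory Defs
  imports "HOL-Analysis.Analysis"
begin

section \<open>Block tensors\<close>

text \<open>
  The space of pairs \<open>(e\<^sub>1, e\<^sub>2)\<close> of vectors in the plane is represented by \<open>real ^ (2 \<times> 2)\<close>:
  the component with index \<open>(i, a)\<close> is the \<open>a\<close>-th coordinate of \<open>e\<^sub>i\<close>. A block operator is then an
  ordinary matrix, its entry \<open>((i, a), (j, b))\<close> being the \<open>(a, b)\<close> entry of the block \<open>(i, j)\<close>, so
  that composition of block operators is the matrix product \<open>**\<close>.
\<close>

type_synonym plane = "real ^ 2"
type_synonym field2 = "real ^ (2 \<times> 2)"
type_synonym tensor = "real ^ (2 \<times> 2) ^ (2 \<times> 2)"

definition kron :: "real ^ 2 ^ 2 \<Rightarrow> real ^ 2 ^ 2 \<Rightarrow> tensor"  (infixl "\<otimes>\<^sub>K" 72)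
  where "P \<otimes>\<^sub>K Q = (\<chi> p q. P $ fst p $ fst q * Q $ snd p $ snd q)"

definition R_perp :: "real ^ 2 ^ 2"
  where "R_perp = vector [vector [0, -1], vector [1, 0]]"

definition T_perp :: tensor
  where "T_perp = R_perp \<otimes>\<^sub>K R_perp"

definition part :: "field2 \<Rightarrow> 2 \<Rightarrow> plane"
  where "part E i = (\<chi> a. E $ (i, a))"

definition sym_pos_def :: "real ^ 'n ^ 'n \<Rightarrow> bool"
  where "sym_pos_def M \<longleftrightarrow> transpose M = M \<and> (\<forall>x. x \<noteq> 0 \<longrightarrow> 0 < x \<bullet> (M *v x))"

definition isotropic :: "real ^ 2 ^ 2 \<Rightarrow> real \<Rightarrow> tensor"
  where "isotropic \<sigma> r = \<sigma> \<otimes>\<^sub>K mat 1 + r *\<^sub>R T_perp"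


section \<open>Periodic function spaces on the unit cell\<close>

abbreviation cell :: "plane set"
  where "cell \<equiv> cbox 0 1"

definition partial :: "2 \<Rightarrow> (plane \<Rightarrow> real) \<Rightarrow> plane \<Rightarrow> real"
  where "partial a f x = frechet_derivative f (at x) (axis a 1)"

definition grad :: "(plane \<Rightarrow> real) \<Rightarrow> plane \<Rightarrow> plane"
  where "grad f x = (\<chi> a. partial a f x)"

primrec C_diff :: "nat \<Rightarrow> (plane \<Rightarrow> real) \<Rightarrow> bool"
  where
    "C_diff 0 f \<longleftrightarrow> continuous_on UNIV f"
  | "C_diff (Suc k) f \<longleftrightarrow> (\<forall>x. f differentiable (at x)) \<and> (\<forall>a. C_diff k (partial a f))"

definition smooth_periodic :: "(plane \<Rightarrow> real) \<Rightarrow> bool"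
  where "smooth_periodic f \<longleftrightarrow> (\<forall>k. C_diff k f) \<and> (\<forall>x a. f (x + axis a 1) = f x)"

definition L2_cell :: "(plane \<Rightarrow> 'b::euclidean_space) \<Rightarrow> bool"
  where "L2_cell f \<longleftrightarrow>
    f \<in> borel_measurable (lebesgue_on cell) \<and> integrable (lebesgue_on cell) (\<lambda>x. (norm (f x))\<^sup>2)"

text \<open>
  Periodic functions and fields are represented by their values on the cell; only these are
  constrained. Periodicity across opposite sides of the cell is enforced by testing against smooth
  periodic functions, which need not vanish on its boundary. Thus \<open>periodic_weak_grad \<phi> g\<close> says that
  the periodic extension of \<open>\<phi>\<close> is in \<open>H\<^sup>1\<^sub>p\<^sub>e\<^sub>r\<close> with distributional gradient \<open>g\<close>, and
  \<open>periodic_div_free J\<close> that the periodic extension of \<open>J\<close> has distributional divergence zero.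
\<close>

definition periodic_weak_grad :: "(plane \<Rightarrow> real) \<Rightarrow> (plane \<Rightarrow> plane) \<Rightarrow> bool"
  where "periodic_weak_grad \<phi> g \<longleftrightarrow> L2_cell \<phi> \<and> L2_cell g \<and>
    (\<forall>\<psi> a. smooth_periodic \<psi> \<longrightarrow>
      (LINT x|lebesgue_on cell. \<phi> x * partial a \<psi> x) = - (LINT x|lebesgue_on cell. g x $ a * \<psi> x))"

definition periodic_div_free :: "(plane \<Rightarrow> plane) \<Rightarrow> bool"
  where "periodic_div_free J \<longleftrightarrow> L2_cell J \<and>
    (\<forall>\<psi>. smooth_periodic \<psi> \<longrightarrow> (LINT x|lebesgue_on cell. J x \<bullet> grad \<psi> x) = 0)"


section \<open>Effective tensor\<close>

definition two_phase :: "plane set \<Rightarrow> tensor \<Rightarrow> tensor \<Rightarrow> plane \<Rightarrow> tensor"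
  where "two_phase A\<^sub>1 L\<^sub>1 L\<^sub>2 x = (if x \<in> A\<^sub>1 then L\<^sub>1 else L\<^sub>2)"

definition cell_solution :: "(plane \<Rightarrow> tensor) \<Rightarrow> field2 \<Rightarrow> (plane \<Rightarrow> field2) \<Rightarrow> bool"
  where "cell_solution L E\<^sub>0 E \<longleftrightarrow>
    (\<exists>\<phi>\<^sub>1 \<phi>\<^sub>2 g\<^sub>1 g\<^sub>2. periodic_weak_grad \<phi>\<^sub>1 g\<^sub>1 \<and> periodic_weak_grad \<phi>\<^sub>2 g\<^sub>2 \<and>
      (\<forall>x\<in>cell. part (E x) 1 = part E\<^sub>0 1 + g\<^sub>1 x \<and> part (E x) 2 = part E\<^sub>0 2 + g\<^sub>2 x)) \<and>
    (\<forall>i. periodic_div_free (\<lambda>x. part (L x *v E x) i))"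

text \<open>
  For bounded measurable coercive \<open>L\<close> the solution \<open>E\<close> exists and is unique up to null sets, so the relation
  determines \<open>L_eff\<close>.
\<close>

definition has_effective_tensor :: "(plane \<Rightarrow> tensor) \<Rightarrow> tensor \<Rightarrow> bool"  (infix "has'_effective'_tensor" 50)
  where "L has_effective_tensor L_eff \<longleftrightarrow>
    (\<forall>E\<^sub>0. \<exists>E. cell_solution L E\<^sub>0 E \<and> L_eff *v E\<^sub>0 = (LINT x|lebesgue_on cell. L x *v E x))"

end

theory Submission
  imports Defs
begin

text \<open>
  Rotating by \<open>R_perp\<close> exchanges divergence-free and curl-free fields of the plane. Hence adding
  \<open>A T_perp\<close> to the local tensor \<open>L\<close> adds \<open>A T_perp\<close> to the effective tensor, and if \<open>E\<close> solves
  the cell problem for \<open>L' = L + A T_perp\<close>, then \<open>E' = K L' E\<close> with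
  \<open>K = T_perp (Z\<^sub>0 \<otimes> R_perp) T_perp\<close> is again curl-free. The constants \<open>A\<close> and \<open>B\<close> are chosen so
  that both phases satisfy \<open>L' K L' = - B (Z\<^sub>0 \<otimes> R_perp)\<close>; therefore \<open>L' E'\<close> is divergence-free,
  \<open>E'\<close> solves the cell problem as well, and averaging gives the same relation for the effective
  tensor. The analytic input is that a square-integrable divergence-free field \<open>J\<close> and a curl-free
  field \<open>H\<close> satisfy \<open>\<integral>J \<bullet> H = \<integral>J \<bullet> \<integral>H\<close>, which follows from density of trigonometric polynomials
  together with their explicit Helmholtz decomposition.
\<close>

subsection \<open>Trigonometric polynomials\<close>

text \<open>The free phase \<open>c\<close> puts sines and cosines into one family: up to a factor,
  differentiation and integration only shift \<open>c\<close> by \<open>pi/2\<close>.\<close>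

definition wave :: "int \<Rightarrow> int \<Rightarrow> real \<Rightarrow> plane \<Rightarrow> real"
  where "wave m n c x = sin (2 * pi * (of_int m * x $ 1 + of_int n * x $ 2) + c)"

text \<open>Linear statements reduce to a single wave by induction. Constants come from frequency
  zero, products from the product-to-sum formula.\<close>

inductive trig :: "(plane \<Rightarrow> real) \<Rightarrow> bool" where
  wave: "trig (wave m n c)"
| add: "trig f \<Longrightarrow> trig g \<Longrightarrow> trig (\<lambda>x. f x + g x)"
| scale: "trig f \<Longrightarrow> trig (\<lambda>x. a * f x)"

lemma trig_const: "trig (\<lambda>x. a)"
proof -
  have "(\<lambda>x. a) = (\<lambda>x. a * wave 0 0 (pi/2) x)"
    by (simp add: wave_def)
  then show ?thesis
    using trig.scale[OF trig.wave, of a 0 0 "pi/2"] by simp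
qed

text \<open>Product-to-sum formula; the shifts by \<open>pi/2\<close> turn both cosines, with their
  signs, back into sines.\<close>

lemma wave_mult:
  "wave m n c x * wave m' n' c' x =
    1/2 * wave (m - m') (n - n') (c - c' + pi/2) x
    + 1/2 * wave (m + m') (n + n') (c + c' - pi/2) x"
proof -
  have "sin a * sin b = 1/2 * sin (a - b + pi/2) + 1/2 * sin (a + b - pi/2)" for a b :: real
    by (simp add: sin_add sin_diff cos_add cos_diff algebra_simps)
  then show ?thesis
    unfolding wave_def by (simp add: algebra_simps)
qed

lemma trig_mult:
  assumes "trig f" "trig g"
  shows "trig (\<lambda>x. f x * g x)"
  using assms(1)
proof induction
  case (wave m n c)
  show ?case
    using assms(2)
  proof induction
    case (wave m' n' c')
    show ?case
      unfolding wave_mult by (intro trig.intros)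
  next
    case (add f g)
    then show ?case
      using trig.add by (simp add: distrib_left)
  next
    case (scale f a)
    then show ?case
      using trig.scale[of _ a] by (simp add: mult.left_commute)
  qed
next
  case (add f g)
  then show ?case
    using trig.add by (simp add: distrib_right)
next
  case (scale f a)
  then show ?case
    using trig.scale[of _ a] by (simp add: mult.assoc)
qed

section \<open>Derivatives and periodicity of trigonometric polynomials\<close>

lemma wave_has_derivative:
  "(wave m n c has_derivative
     (\<lambda>h. 2 * pi * (of_int m * h $ 1 + of_int n * h $ 2) * wave m n (c + pi/2) x)) (at x)"
proof -
  have "((\<lambda>x. sin (2 * pi * (of_int m * x $ 1 + of_int n * x $ 2) + c)) has_derivative
     (\<lambda>h. (2 * pi * (of_int m * h $ 1 + of_int n * h $ 2)) *
        cos (2 * pi * (of_int m * x $ 1 + of_int n * x $ 2) + c))) (at x)"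
    by (auto intro!: derivative_eq_intros bounded_linear_imp_has_derivative
        bounded_linear_vec_nth)
  then show ?thesis
    unfolding wave_def[abs_def] by (simp add: sin_add add.assoc[symmetric])
qed

lemma trig_differentiable: "trig f \<Longrightarrow> f differentiable (at x)"
proof (induction rule: trig.induct)
  case (wave m n c)
  show ?case
    unfolding differentiable_def using wave_has_derivative by blast
qed simp_all

lemma trig_continuous: "trig f \<Longrightarrow> continuous_on S f"
  by (meson continuous_at_imp_continuous_on differentiable_imp_continuous_within trig_differentiable)

lemma partial_wave:
  "partial a (wave m n c) =
    (\<lambda>x. 2 * pi * (if a = 1 then of_int m else of_int n) * wave m n (c + pi/2) x)"
proof
  fix x :: plane
  show "partial a (wave m n c) x =
    2 * pi * (if a = 1 then of_int m else of_int n) * wave m n (c + pi/2) x"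
    unfolding partial_def frechet_derivative_at[OF wave_has_derivative, symmetric]
    using exhaust_2[of a] by (auto simp: axis_def)
qed

lemma partial_add:
  assumes "\<And>x. f differentiable (at x)" "\<And>x. g differentiable (at x)"
  shows "partial a (\<lambda>x. f x + g x) = (\<lambda>x. partial a f x + partial a g x)"
proof
  fix x
  have "((\<lambda>x. f x + g x) has_derivative
    (\<lambda>h. frechet_derivative f (at x) h + frechet_derivative g (at x) h)) (at x)"
    using assms by (intro has_derivative_add) (simp_all add: frechet_derivative_works)
  from frechet_derivative_at[OF this, symmetric]
  show "partial a (\<lambda>x. f x + g x) x = partial a f x + partial a g x"
    by (simp add: partial_def)
qed

lemma partial_scale:
  assumes "\<And>x. f differentiable (at x)"
  shows "partial a (\<lambda>x. b * f x) = (\<lambda>x. b * partial a f x)"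
proof
  fix x
  have "((\<lambda>x. b * f x) has_derivative (\<lambda>h. b * frechet_derivative f (at x) h)) (at x)"
    using assms[of x] by (intro has_derivative_mult_right) (simp add: frechet_derivative_works)
  from frechet_derivative_at[OF this, symmetric]
  show "partial a (\<lambda>x. b * f x) x = b * partial a f x"
    by (simp add: partial_def)
qed

lemma partial_mult:
  assumes "\<And>x. f differentiable (at x)" "\<And>x. g differentiable (at x)"
  shows "partial a (\<lambda>x. f x * g x) x = f x * partial a g x + partial a f x * g x"
proof -
  have "((\<lambda>x. f x * g x) has_derivative
    (\<lambda>h. f x * frechet_derivative g (at x) h + frechet_derivative f (at x) h * g x)) (at x)"
    using assms by (intro has_derivative_mult) (simp_all add: frechet_derivative_works)
  from frechet_derivative_at[OF this, symmetric] show ?thesis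
    by (simp add: partial_def)
qed

lemmas trig_partial_simps =
  partial_wave partial_add[OF trig_differentiable trig_differentiable]
  partial_scale[OF trig_differentiable]

lemma trig_partial: "trig f \<Longrightarrow> trig (partial a f)"
proof (induction rule: trig.induct)
  case (wave m n c)
  show ?case
    unfolding partial_wave by (intro trig.intros)
qed (simp_all add: trig_partial_simps trig.intros)

text \<open>On a wave, both orders produce the same factors and phase shifts. This symmetry lies
  behind the cancellations between gradients and rotated gradients below.\<close>

lemma trig_partial_commute: "trig f \<Longrightarrow> partial a (partial b f) = partial b (partial a f)"
proof (induction rule: trig.induct)
  case (wave m n c)
  show ?case
    unfolding partial_wave partial_scale[OF trig_differentiable[OF trig.wave]]
    by (simp add: mult_ac)
qed (simp_all add: trig_partial_simps trig_partial)

lemma trig_periodic: "trig f \<Longrightarrow> f (x + axis a 1) = f x"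
proof (induction rule: trig.induct)
  case (wave m n c)
  have *: "sin (y + 2 * pi * of_int k) = sin y" "sin (2 * pi * of_int k + y) = sin y" for y k
    by (simp_all add: sin_add)
  from exhaust_2[of a] show ?case
  proof
    assume "a = 1"
    then have "wave m n c (x + axis a 1) =
        sin ((2 * pi * (of_int m * x $ 1 + of_int n * x $ 2) + c) + 2 * pi * of_int m)"
      by (simp add: wave_def axis_def algebra_simps)
    then show ?thesis by (simp add: * wave_def)
  next
    assume "a = 2"
    then have "wave m n c (x + axis a 1) =
        sin ((2 * pi * (of_int m * x $ 1 + of_int n * x $ 2) + c) + 2 * pi * of_int n)"
      by (simp add: wave_def axis_def algebra_simps)
    then show ?thesis by (simp add: * wave_def)
  qed
qed simp_all

text \<open>Makes trigonometric polynomials admissible test functions in the weak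
  formulations.\<close>

lemma trig_smooth_periodic:
  assumes "trig f"
  shows "smooth_periodic f"
proof -
  have "C_diff k f" for k
    using assms
    by (induction k arbitrary: f) (simp_all add: trig_continuous trig_differentiable trig_partial)
  then show ?thesis
    using assms by (simp add: smooth_periodic_def trig_periodic)
qed

section \<open>Integrals over one period\<close>

lemma integral_cell_translate:
  fixes f :: "plane \<Rightarrow> real"
  assumes cont: "continuous_on UNIV f" and per: "\<And>x. f (x + axis a 1) = f x"
    and t: "0 \<le> t" "t \<le> 1"
  shows "integral cell (\<lambda>x. f (x + t *\<^sub>R axis a 1)) = integral cell f"
proof -
  define e where "e = (axis a 1 :: plane)"
  have e: "e \<in> Basis" by (simp add: e_def axis_in_Basis_iff)
  have int: "f integrable_on cbox u v" for u v
    by (intro integrable_continuous continuous_on_subset[OF cont]) auto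
  have split: "cbox u v \<inter> {x. x \<bullet> e \<le> s} = cbox u (\<chi> i. if i = a then min (v $ a) s else v $ i)"
    "cbox u v \<inter> {x. x \<bullet> e \<ge> s} = cbox (\<chi> i. if i = a then max (u $ a) s else u $ i) v"
    for u v :: plane and s
    by (auto simp: mem_box_cart e_def inner_axis split: if_splits)
  \<comment> \<open>The translated cell is cut at coordinate 1 along \<open>e\<close>. The piece
    inside the cell is the slab \<open>hi\<close>; the overhang is the slab \<open>lo\<close> moved
    by one period, so periodicity brings it back and the two fill the cell.\<close>
  define lo hi where "lo = cbox 0 (\<chi> i. if i = a then t else 1)"
    and "hi = cbox (\<chi> i. if i = a then t else 0) (1 :: plane)"
  have "integral cell (\<lambda>x. f (x + t *\<^sub>R e)) = integral (cbox (t *\<^sub>R e) (1 + t *\<^sub>R e)) f"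
    using integral_shift_cbox[of "t *\<^sub>R e" "t *\<^sub>R e" "1 + t *\<^sub>R e" f] by simp
  also have "\<dots> = integral hi f + integral (cbox (0 + e) ((\<chi> i. if i = a then t else 1) + e)) f"
  proof -
    have *: "cbox (t *\<^sub>R e) (1 + t *\<^sub>R e) \<inter> {x. x \<bullet> e \<le> 1} = hi"
      unfolding split hi_def using t
      by (intro arg_cong2[where f = cbox]) (auto simp: vec_eq_iff e_def axis_def)
    have **: "cbox (t *\<^sub>R e) (1 + t *\<^sub>R e) \<inter> {x. x \<bullet> e \<ge> 1} =
        cbox (0 + e) ((\<chi> i. if i = a then t else 1) + e)"
      unfolding split using t
      by (intro arg_cong2[where f = cbox]) (auto simp: vec_eq_iff e_def axis_def)
    show ?thesis
      using integral_split[OF int e, of "t *\<^sub>R e" "1 + t *\<^sub>R e" 1] unfolding * ** .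
  qed
  also have "integral (cbox (0 + e) ((\<chi> i. if i = a then t else 1) + e)) f = integral lo f"
    unfolding lo_def
    using integral_shift_cbox[of "0 + e" e "(\<chi> i. if i = a then t else 1) + e" f] per
    by (simp add: e_def)
  also have "integral hi f + integral lo f = integral cell f"
  proof -
    have *: "cell \<inter> {x. x \<bullet> e \<le> t} = lo"
      unfolding split lo_def using t
      by (intro arg_cong2[where f = cbox]) (auto simp: vec_eq_iff)
    have **: "cell \<inter> {x. x \<bullet> e \<ge> t} = hi"
      unfolding split hi_def using t
      by (intro arg_cong2[where f = cbox]) (auto simp: vec_eq_iff)
    show ?thesis
      using integral_split[OF int e, of 0 1 t] unfolding * ** by simp
  qed
  finally show ?thesis by (simp add: e_def)
qed

lemma continuous_integrable_cell:
  fixes f :: "plane \<Rightarrow> 'b::euclidean_space"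
  assumes "continuous_on UNIV f"
  shows "integrable (lebesgue_on cell) f"
  using assms continuous_on_subset
  by (intro continuous_imp_integrable) blast

lemma integral_wave_zero:
  assumes "m \<noteq> 0 \<or> n \<noteq> 0"
  shows "(LINT x|lebesgue_on cell. wave m n c x) = 0"
proof -
  obtain a :: 2 and k where k: "k = (if a = 1 then m else n)" "k \<noteq> 0"
    using assms by (metis (full_types) one_neq_zero zero_neq_one)
  define t where "t = 1 / (2 * \<bar>real_of_int k\<bar>)"
  \<comment> \<open>The frequency \<open>k\<close> may be negative, so the phase shift is
    \<open>pi\<close> or \<open>- pi\<close>; either one reverses the sine.\<close>
  have t: "0 \<le> t" "t \<le> 1" "2 * (of_int k * t) = sgn (of_int k)"
    using k(2) by (auto simp: t_def field_simps sgn_if abs_if)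
  \<comment> \<open>Translating by half a wavelength along the axis \<open>a\<close> flips the sign.\<close>
  have "wave m n c (x + t *\<^sub>R axis a 1) = - wave m n c x" for x
  proof -
    have "wave m n c (x + t *\<^sub>R axis a 1) =
        sin (2 * pi * (of_int m * x $ 1 + of_int n * x $ 2) + c + pi * (2 * (of_int k * t)))"
      using exhaust_2[of a] k by (auto simp: wave_def axis_def algebra_simps)
    also have "\<dots> = - wave m n c x"
      using k(2) unfolding t(3) wave_def by (auto simp: sgn_if sin_add sin_diff)
    finally show ?thesis .
  qed
  then have "integral cell (wave m n c) = - integral cell (wave m n c)"
    using integral_cell_translate[OF trig_continuous[OF trig.wave] trig_periodic[OF trig.wave] t(1,2), of m n c a]
    by simp
  then show ?thesis
    by (simp add: lebesgue_integral_eq_integral continuous_integrable_cell trig_continuous trig.wave)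
qed

lemma trig_integrable: "trig f \<Longrightarrow> integrable (lebesgue_on cell) f"
  by (simp add: continuous_integrable_cell trig_continuous)

text \<open>The derivative of a wave carries the corresponding frequency as a factor, so it is zero
  or a multiple of a nonconstant wave, whose mean vanishes.\<close>

lemma integral_trig_partial: "trig f \<Longrightarrow> (LINT x|lebesgue_on cell. partial a f x) = 0"
proof (induction rule: trig.induct)
  case (wave m n c)
  show ?case
    unfolding partial_wave using integral_wave_zero[of m n "c + pi/2"] by auto
qed (simp_all add: trig_partial_simps trig_integrable trig_partial)

text \<open>Explicit Helmholtz decomposition: a wave of frequency zero goes into the mean
  \<open>c\<close>; for any other wave, \<open>v\<close> is split along the frequency vector
  (gradient) and perpendicular to it (rotated gradient). Fixing \<open>v\<close> lets the induction
  run over scalar polynomials.\<close>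

lemma trig_helmholtz_component:
  assumes "trig f"
  shows "\<exists>c \<phi> \<psi>. trig \<phi> \<and> trig \<psi> \<and> (\<forall>x. f x *\<^sub>R v = c + grad \<phi> x + R_perp *v grad \<psi> x)"
  using assms
proof induction
  case (wave m n c)
  show ?case
  proof (cases "m = 0 \<and> n = 0")
    case True
    have "grad (\<lambda>x. 0) = (\<lambda>x. 0)"
      by (simp add: grad_def partial_def fun_eq_iff vec_eq_iff)
    then have "\<forall>x. wave m n c x *\<^sub>R v = sin c *\<^sub>R v + grad (\<lambda>x. 0) x + R_perp *v grad (\<lambda>x. 0) x"
      using True by (simp add: wave_def)
    then show ?thesis
      using trig_const by blast
  next
    case False
    define \<mu> \<nu> :: real where "\<mu> = of_int m" and "\<nu> = of_int n"
    define q where "q = \<mu>\<^sup>2 + \<nu>\<^sup>2"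
    have q: "q \<noteq> 0"
      using False by (simp add: q_def \<mu>_def \<nu>_def sum_power2_eq_zero_iff)
    \<comment> \<open>Coefficients of \<open>v\<close> in the orthogonal basis
      \<open>(\<mu>, \<nu>)\<close>, \<open>(- \<nu>, \<mu>)\<close>, divided by the factor
      \<open>2 * pi\<close> that differentiation produces.\<close>
    define \<alpha> \<beta> where "\<alpha> = (v $ 1 * \<mu> + v $ 2 * \<nu>) / (2 * pi * q)"
      and "\<beta> = (v $ 2 * \<mu> - v $ 1 * \<nu>) / (2 * pi * q)"
    \<comment> \<open>Differentiation advances the phase by \<open>pi/2\<close>, so the potentials
      start from the phase \<open>c - pi/2\<close>.\<close>
    define \<phi> \<psi> where "\<phi> = (\<lambda>x. \<alpha> * wave m n (c - pi/2) x)" and "\<psi> = (\<lambda>x. \<beta> * wave m n (c - pi/2) x)"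
    have 1: "v $ 1 = 2 * pi * (\<alpha> * \<mu> - \<beta> * \<nu>)" and 2: "v $ 2 = 2 * pi * (\<alpha> * \<nu> + \<beta> * \<mu>)"
      using q by (simp_all add: \<alpha>_def \<beta>_def field_simps) (simp_all add: q_def power2_eq_square algebra_simps)
    have "wave m n c x *\<^sub>R v = 0 + grad \<phi> x + R_perp *v grad \<psi> x" for x
      by (simp add: \<phi>_def \<psi>_def grad_def trig_partial_simps trig.wave vec_eq_iff forall_2
          R_perp_def matrix_vector_mult_def sum_2 1 2 \<mu>_def[symmetric] \<nu>_def[symmetric] algebra_simps)
    moreover have "trig \<phi>" "trig \<psi>"
      by (simp_all add: \<phi>_def \<psi>_def trig.intros)
    ultimately show ?thesis by blast
  qed
next
  case (add f g)
  then obtain c \<phi> \<psi> c' \<phi>' \<psi>' where *: "trig \<phi>" "trig \<psi>" "trig \<phi>'" "trig \<psi>'"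
    "\<And>x. f x *\<^sub>R v = c + grad \<phi> x + R_perp *v grad \<psi> x"
    "\<And>x. g x *\<^sub>R v = c' + grad \<phi>' x + R_perp *v grad \<psi>' x"
    by blast
  have "(f x + g x) *\<^sub>R v =
      (c + c') + grad (\<lambda>x. \<phi> x + \<phi>' x) x + R_perp *v grad (\<lambda>x. \<psi> x + \<psi>' x) x" for x
  proof -
    have "grad (\<lambda>x. \<phi> x + \<phi>' x) x = grad \<phi> x + grad \<phi>' x" "grad (\<lambda>x. \<psi> x + \<psi>' x) x = grad \<psi> x + grad \<psi>' x"
      using *(1-4) by (simp_all add: grad_def trig_partial_simps vec_eq_iff)
    then show ?thesis
      by (simp add: scaleR_left_distrib *(5,6) matrix_vector_right_distrib)
  qed
  then show ?case
    using * by (intro exI conjI allI; (assumption | simp add: trig.add)?)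
next
  case (scale f a)
  then obtain c \<phi> \<psi> where *: "trig \<phi>" "trig \<psi>"
    "\<And>x. f x *\<^sub>R v = c + grad \<phi> x + R_perp *v grad \<psi> x"
    by blast
  have "(a * f x) *\<^sub>R v = a *\<^sub>R c + grad (\<lambda>x. a * \<phi> x) x + R_perp *v grad (\<lambda>x. a * \<psi> x) x" for x
  proof -
    have "grad (\<lambda>x. a * \<phi> x) x = a *\<^sub>R grad \<phi> x" "grad (\<lambda>x. a * \<psi> x) x = a *\<^sub>R grad \<psi> x"
      using *(1,2) by (simp_all add: grad_def trig_partial_simps vec_eq_iff)
    moreover have "(a * f x) *\<^sub>R v = a *\<^sub>R (c + grad \<phi> x + R_perp *v grad \<psi> x)"
      by (simp flip: *(3))
    ultimately show ?thesis
      by (simp add: scaleR_right_distrib matrix_vector_mult_scaleR)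
  qed
  then show ?case
    using * by (intro exI conjI allI; (assumption | simp add: trig.scale)?)
qed

subsection \<open>Density of trigonometric polynomials\<close>

lemma L2_cell_bound:
  fixes f :: "plane \<Rightarrow> 'b::euclidean_space"
  assumes "f \<in> borel_measurable (lebesgue_on cell)" "integrable (lebesgue_on cell) g"
    "\<And>x. x \<in> cell \<Longrightarrow> (norm (f x))\<^sup>2 \<le> g x"
  shows "L2_cell f"
proof -
  have "AE x in lebesgue_on cell. norm ((norm (f x))\<^sup>2) \<le> norm (g x)"
    using assms(3) by (intro AE_I2) fastforce
  then show ?thesis
    unfolding L2_cell_def
    using assms(1) by (intro conjI Bochner_Integration.integrable_bound[OF assms(2)]) auto
qed

lemma L2_cell_measurable: "L2_cell f \<Longrightarrow> f \<in> borel_measurable (lebesgue_on cell)"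
  and L2_cell_integrable_power2: "L2_cell f \<Longrightarrow> integrable (lebesgue_on cell) (\<lambda>x. (norm (f x))\<^sup>2)"
  by (simp_all add: L2_cell_def)

lemma L2_cell_integrable_inner:
  fixes f g :: "plane \<Rightarrow> 'b::euclidean_space"
  assumes "L2_cell f" "L2_cell g"
  shows "integrable (lebesgue_on cell) (\<lambda>x. f x \<bullet> g x)"
proof (rule Bochner_Integration.integrable_bound)
  show "integrable (lebesgue_on cell) (\<lambda>x. (norm (f x))\<^sup>2 + (norm (g x))\<^sup>2)"
    using assms by (simp add: L2_cell_def)
  show "(\<lambda>x. f x \<bullet> g x) \<in> borel_measurable (lebesgue_on cell)"
    using assms[THEN L2_cell_measurable] by measurable
  have "\<bar>f x \<bullet> g x\<bar> \<le> (norm (f x))\<^sup>2 + (norm (g x))\<^sup>2" for x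
  proof -
    have "\<bar>f x \<bullet> g x\<bar> \<le> norm (f x) * norm (g x)"
      by (rule Cauchy_Schwarz_ineq2)
    also have "\<dots> \<le> (norm (f x))\<^sup>2 + (norm (g x))\<^sup>2"
      using sum_squares_bound[of "norm (f x)" "norm (g x)"]
        mult_nonneg_nonneg[OF norm_ge_zero norm_ge_zero, of "f x" "g x"] by linarith
    finally show ?thesis .
  qed
  then show "AE x in lebesgue_on cell. norm (f x \<bullet> g x) \<le> norm ((norm (f x))\<^sup>2 + (norm (g x))\<^sup>2)"
    by (intro AE_I2) (simp add: abs_of_nonneg)
qed

lemma L2_cell_continuous:
  fixes f :: "plane \<Rightarrow> 'b::euclidean_space"
  assumes "continuous_on UNIV f"
  shows "L2_cell f"
  unfolding L2_cell_def
proof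
  show "f \<in> borel_measurable (lebesgue_on cell)"
    using continuous_integrable_cell[OF assms] by (rule borel_measurable_integrable)
  have "continuous_on UNIV (\<lambda>x. (norm (f x))\<^sup>2)"
    by (intro continuous_on_power continuous_on_norm assms)
  then show "integrable (lebesgue_on cell) (\<lambda>x. (norm (f x))\<^sup>2)"
    by (rule continuous_integrable_cell)
qed

lemma L2_cell_const: "L2_cell (\<lambda>x. c :: 'b::euclidean_space)"
  by (simp add: L2_cell_continuous)

text \<open>Each component is an inner product with a constant field, which is square-integrable
  because the cell is bounded.\<close>

lemma L2_cell_integrable:
  fixes f :: "plane \<Rightarrow> 'b::euclidean_space"
  assumes "L2_cell f"
  shows "integrable (lebesgue_on cell) f"
proof -
  have "integrable (lebesgue_on cell) (\<lambda>x. \<Sum>b\<in>Basis. (f x \<bullet> b) *\<^sub>R b)"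
    by (intro Bochner_Integration.integrable_sum integrable_scaleR_left impI
        L2_cell_integrable_inner[OF assms L2_cell_const])
  then show ?thesis
    by (simp add: euclidean_representation)
qed

lemma L2_cell_add:
  fixes f g :: "plane \<Rightarrow> 'b::euclidean_space"
  assumes "L2_cell f" "L2_cell g"
  shows "L2_cell (\<lambda>x. f x + g x)"
proof (rule L2_cell_bound)
  show "integrable (lebesgue_on cell) (\<lambda>x. 2 * (norm (f x))\<^sup>2 + 2 * (norm (g x))\<^sup>2)"
    using assms by (simp add: L2_cell_def)
  show "(norm (f x + g x))\<^sup>2 \<le> 2 * (norm (f x))\<^sup>2 + 2 * (norm (g x))\<^sup>2" for x
  proof -
    have "(norm (f x + g x))\<^sup>2 \<le> (norm (f x) + norm (g x))\<^sup>2"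
      by (intro power_mono norm_triangle_ineq) simp
    also have "\<dots> \<le> 2 * (norm (f x))\<^sup>2 + 2 * (norm (g x))\<^sup>2"
      using sum_squares_bound[of "norm (f x)" "norm (g x)"] by (simp add: power2_sum)
    finally show ?thesis .
  qed
  show "(\<lambda>x. f x + g x) \<in> borel_measurable (lebesgue_on cell)"
    using assms[THEN L2_cell_measurable] by measurable
qed

lemma L2_cell_linear:
  fixes f :: "plane \<Rightarrow> 'b::euclidean_space" and T :: "'b \<Rightarrow> 'c::euclidean_space"
  assumes "linear T" "L2_cell f"
  shows "L2_cell (\<lambda>x. T (f x))"
proof -
  have T: "bounded_linear T"
    using assms(1) linear_conv_bounded_linear by blast
  obtain K where K: "\<And>y. norm (T y) \<le> norm y * K"
    using bounded_linear.bounded[OF T] by blast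
  show ?thesis
  proof (rule L2_cell_bound)
    show "(\<lambda>x. T (f x)) \<in> borel_measurable (lebesgue_on cell)"
      using L2_cell_measurable[OF assms(2)]
        borel_measurable_continuous_onI[OF linear_continuous_on[OF T]]
      by (rule measurable_compose)
    show "integrable (lebesgue_on cell) (\<lambda>x. (norm (f x))\<^sup>2 * K\<^sup>2)"
      using assms(2) by (simp add: L2_cell_def)
    show "(norm (T (f x)))\<^sup>2 \<le> (norm (f x))\<^sup>2 * K\<^sup>2" for x
      unfolding power_mult_distrib[symmetric] by (intro power_mono K) simp
  qed
qed

lemma L2_cell_diff:
  fixes f g :: "plane \<Rightarrow> 'b::euclidean_space"
  assumes "L2_cell f" "L2_cell g"
  shows "L2_cell (\<lambda>x. f x - g x)"
proof -
  have "linear (\<lambda>y::'b. - y)"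
    by (intro bounded_linear.linear bounded_linear_minus bounded_linear_ident)
  from L2_cell_add[OF assms(1) L2_cell_linear[OF this assms(2)]] show ?thesis
    by simp
qed

text \<open>Equal phases force \<open>s - t\<close> to be an integer, and inside the unit interval a
  nonzero one can only be 1 or -1. Hence points of the cell that coincide on the torus lie on its
  boundary.\<close>

lemma cis_eq_imp_endpoints:
  assumes "cis (2 * pi * s) = cis (2 * pi * t)" "0 \<le> s" "s \<le> 1" "0 \<le> t" "t \<le> 1" "s \<noteq> t"
  shows "s \<in> {0, 1}" "t \<in> {0, 1}"
proof -
  have "sin (2 * pi * s) = sin (2 * pi * t) \<and> cos (2 * pi * s) = cos (2 * pi * t)"
    using arg_cong[OF assms(1), of Re] arg_cong[OF assms(1), of Im] by (simp only: cis.sel)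
  then obtain n :: int where "2 * pi * s = 2 * pi * t + 2 * pi * of_int n"
    unfolding sin_cos_eq_iff by blast
  then have "2 * pi * s = 2 * pi * (t + of_int n)"
    by (simp only: distrib_left)
  then have n: "s = t + of_int n"
    unfolding mult_cancel_left using pi_neq_zero by linarith
  have "n \<noteq> 0"
    using n assms(6) by (intro notI) simp
  moreover have "real_of_int n < 2" "real_of_int n > - 2"
    using n assms(2-5) by linarith+
  ultimately have "n = 1 \<or> n = -1" by linarith
  then have "s = t + 1 \<or> s = t - 1"
    using n by (elim disjE) simp_all
  then have "s = 1 \<and> t = 0 \<or> s = 0 \<and> t = 1"
    using assms(2-5) by linarith
  then show "s \<in> {0, 1}" "t \<in> {0, 1}"
    by (elim disjE conjE; simp)+
qed

text \<open>The real coordinates of the torus embedding are waves, so closure under sums, multiples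
  and products covers every polynomial in them.\<close>

lemma trig_real_polynomial_cis:
  fixes p :: "complex \<times> complex \<Rightarrow> real"
  assumes "real_polynomial_function p"
  shows "trig (\<lambda>x. p (cis (2 * pi * x $ 1), cis (2 * pi * x $ 2)))"
  using assms
proof induction
  case (linear f)
  interpret f: bounded_linear f by fact
  have "f (cis (2 * pi * x $ 1), cis (2 * pi * x $ 2)) =
      (f (1, 0) * wave 1 0 (pi/2) x + f (\<i>, 0) * wave 1 0 0 x)
      + (f (0, 1) * wave 0 1 (pi/2) x + f (0, \<i>) * wave 0 1 0 x)" for x
  proof -
    have *: "f (z, w) = (Re z * f (1, 0) + Im z * f (\<i>, 0)) + (Re w * f (0, 1) + Im w * f (0, \<i>))"
      for z w
    proof -
      have "(z, w) = (Re z *\<^sub>R (1, 0) + Im z *\<^sub>R (\<i>, 0)) + (Re w *\<^sub>R (0, 1) + Im w *\<^sub>R (0, \<i>))"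
        using complex_eq[of z] complex_eq[of w] by (simp add: scaleR_conv_of_real mult.commute)
      then show ?thesis
        by (simp only: f.add f.scaleR real_scaleR_def)
    qed
    have **: "wave 1 0 (pi/2) x = Re (cis (2 * pi * x $ 1))" "wave 1 0 0 x = Im (cis (2 * pi * x $ 1))"
      "wave 0 1 (pi/2) x = Re (cis (2 * pi * x $ 2))" "wave 0 1 0 x = Im (cis (2 * pi * x $ 2))"
      by (simp_all add: wave_def sin_add)
    show ?thesis
      unfolding ** *[of "cis (2 * pi * x $ 1)" "cis (2 * pi * x $ 2)"] by (simp only: mult.commute)
  qed
  then show ?case
    by (simp only:) (intro trig.add trig.scale trig.wave)
next
  case (const c)
  show ?case by (rule trig_const)
next
  case (add f g)
  show ?case by (rule trig.add[OF add.IH])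
next
  case (mult f g)
  show ?case by (rule trig_mult[OF mult.IH])
qed

lemma trig_uniformly_dense:
  fixes f :: "plane \<Rightarrow> real"
  assumes cont: "continuous_on cell f"
    and zero: "\<And>x a. x \<in> cell \<Longrightarrow> x $ a \<in> {0, 1} \<Longrightarrow> f x = 0"
    and "e > 0"
  obtains p where "trig p" "\<And>x. x \<in> cell \<Longrightarrow> \<bar>f x - p x\<bar> < e"
proof -
  \<comment> \<open>Vanishing on the boundary, \<open>f\<close> descends to the torus, where Stone--Weierstrass applies.\<close>
  define \<tau> :: "plane \<Rightarrow> complex \<times> complex"
    where "\<tau> x = (cis (2 * pi * x $ 1), cis (2 * pi * x $ 2))" for x
  \<comment> \<open>\<open>h\<close> is \<open>f\<close> read on the torus through an arbitrary
    preimage. By \<open>eq\<close> the choice does not matter: distinct points with the same image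
    lie on the boundary, where \<open>f\<close> vanishes.\<close>
  define h where "h z = f (SOME x. x \<in> cell \<and> \<tau> x = z)" for z
  have eq: "f x = f y" if "x \<in> cell" "y \<in> cell" "\<tau> x = \<tau> y" for x y
  proof (cases "x = y")
    case False
    then obtain a where "x $ a \<noteq> y $ a"
      by (auto simp: vec_eq_iff)
    moreover have "cis (2 * pi * x $ a) = cis (2 * pi * y $ a)"
      using that(3) exhaust_2[of a] by (auto simp: \<tau>_def)
    moreover have "0 \<le> x $ a" "x $ a \<le> 1" "0 \<le> y $ a" "y $ a \<le> 1"
      using that(1,2) by (simp_all add: mem_box_cart)
    ultimately have "x $ a \<in> {0, 1}" "y $ a \<in> {0, 1}"
      using cis_eq_imp_endpoints by blast+
    then show ?thesis
      using zero that by simp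
  qed simp
  have h: "h (\<tau> x) = f x" if "x \<in> cell" for x
  proof -
    have "(SOME y. y \<in> cell \<and> \<tau> y = \<tau> x) \<in> cell \<and> \<tau> (SOME y. y \<in> cell \<and> \<tau> y = \<tau> x) = \<tau> x"
      by (rule someI[of _ x]) (simp add: that)
    then show ?thesis
      unfolding h_def by (blast intro: eq that)
  qed
  have cis_cont: "continuous_on cell (\<lambda>x. cis (2 * pi * x $ a))" for a
    unfolding cis_conv_exp by (intro continuous_intros)
  then have \<tau>_cont: "continuous_on cell \<tau>"
    unfolding \<tau>_def[abs_def] by (intro continuous_on_Pair)
  have S: "compact (\<tau> ` cell)"
    by (intro compact_continuous_image \<tau>_cont) auto
  \<comment> \<open>Quotient argument: \<open>\<tau>\<close> sends closed subsets of the compact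
    cell to compact sets, so preimages of closed sets under \<open>h\<close> are closed.\<close>
  have "continuous_on (\<tau> ` cell) h"
  proof (subst continuous_on_closed_vimage)
    show "closed (\<tau> ` cell)"
      using S by (rule compact_imp_closed)
    show "\<forall>B. closed B \<longrightarrow> closed (h -` B \<inter> \<tau> ` cell)"
    proof (intro allI impI)
      fix B :: "real set"
      assume "closed B"
      then have "closed (f -` B \<inter> cell)"
        using cont continuous_on_closed_vimage[OF closed_cbox, of 0 1 f] by blast
      then have "compact (f -` B \<inter> cell \<inter> cell)"
        by (intro closed_Int_compact) simp_all
      then have "compact (f -` B \<inter> cell)"
        by (simp add: Int_assoc)
      then have "compact (\<tau> ` (f -` B \<inter> cell))"
        by (intro compact_continuous_image continuous_on_subset[OF \<tau>_cont]) auto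
      moreover have "h -` B \<inter> \<tau> ` cell = \<tau> ` (f -` B \<inter> cell)"
        using h by auto
      ultimately show "closed (h -` B \<inter> \<tau> ` cell)"
        by (simp add: compact_imp_closed)
    qed
  qed
  then obtain g where g: "real_polynomial_function g" "\<And>z. z \<in> \<tau> ` cell \<Longrightarrow> \<bar>h z - g z\<bar> < e"
    using Stone_Weierstrass_real_polynomial_function[OF S _ \<open>e > 0\<close>] by blast
  show thesis
  proof
    show "trig (\<lambda>x. g (\<tau> x))"
      using trig_real_polynomial_cis[OF g(1)] by (simp add: \<tau>_def)
    show "\<bar>f x - g (\<tau> x)\<bar> < e" if "x \<in> cell" for x
      using g(2)[of "\<tau> x"] h[OF that] that by auto
  qed
qed

section \<open>Approximation in mean square\<close>

lemma L2_cell_integrable_power2_diff: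
  fixes f g :: "plane \<Rightarrow> real"
  assumes "L2_cell f" "L2_cell g"
  shows "integrable (lebesgue_on cell) (\<lambda>x. (f x - g x)\<^sup>2)"
  using L2_cell_integrable_power2[OF L2_cell_diff[OF assms]] by simp

text \<open>Squared triangle inequality; its factors 2 explain the tolerances \<open>e / 4\<close>
  below.\<close>

lemma integral_power2_diff_le:
  fixes f g h :: "plane \<Rightarrow> real"
  assumes "L2_cell f" "L2_cell g" "L2_cell h"
  shows "(LINT x|lebesgue_on cell. (f x - h x)\<^sup>2) \<le>
    2 * (LINT x|lebesgue_on cell. (f x - g x)\<^sup>2) + 2 * (LINT x|lebesgue_on cell. (g x - h x)\<^sup>2)"
proof -
  note int = L2_cell_integrable_power2_diff[OF assms(1,3)]
    L2_cell_integrable_power2_diff[OF assms(1,2)] L2_cell_integrable_power2_diff[OF assms(2,3)]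
  have "(a + b)\<^sup>2 \<le> 2 * a\<^sup>2 + 2 * b\<^sup>2" for a b :: real
    using sum_squares_bound[of a b] unfolding power2_sum by linarith
  from this[of "f x - g x" "g x - h x" for x]
  have "(LINT x|lebesgue_on cell. (f x - h x)\<^sup>2) \<le>
      (LINT x|lebesgue_on cell. 2 * (f x - g x)\<^sup>2 + 2 * (g x - h x)\<^sup>2)"
    by (intro integral_mono int Bochner_Integration.integrable_add integrable_mult_right) simp
  also have "\<dots> = 2 * (LINT x|lebesgue_on cell. (f x - g x)\<^sup>2) + 2 * (LINT x|lebesgue_on cell. (g x - h x)\<^sup>2)"
    using int(2,3) by simp
  finally show ?thesis .
qed

lemma measure_cell: "measure (lebesgue_on cell) cell = 1"
  by (simp add: measure_restrict_space content_cbox_cart interval_ne_empty_cart)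

text \<open>Measurability supplies continuous functions converging almost everywhere. Clamped and
  cut off at the boundary, they converge in mean square by dominated convergence and are uniformly
  approximable by trigonometric polynomials.\<close>

lemma trig_dense_L2_bounded:
  fixes f :: "plane \<Rightarrow> real"
  assumes f: "f \<in> borel_measurable (lebesgue_on cell)" and bound: "\<And>x. \<bar>f x\<bar> \<le> N" and "e > 0"
  obtains p where "trig p" "(LINT x|lebesgue_on cell. (f x - p x)\<^sup>2) < e"
proof -
  have "f measurable_on cell"
    using f by (simp add: measurable_on_iff_borel_measurable)
  then obtain Z g where Z: "negligible Z" and g: "\<And>n. continuous_on UNIV (g n)"
    and lim: "\<And>x. x \<notin> Z \<Longrightarrow> (\<lambda>n. g n x) \<longlonglongrightarrow> (if x \<in> cell then f x else 0)"
    unfolding measurable_on_def by blast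
  \<comment> \<open>\<open>b\<close> is positive inside the cell and zero on its boundary, so
    \<open>min 1 (real n * b x)\<close> is a cutoff that equals 1 at any given interior point once
    \<open>n\<close> is large. Clamping to \<open>[- N, N]\<close> gives the dominating bound and
    keeps the limit \<open>f x\<close>.\<close>
  define b :: "plane \<Rightarrow> real" where "b x = x $ 1 * (1 - x $ 1) * (x $ 2 * (1 - x $ 2))" for x
  define h where "h n x = min 1 (real n * b x) * max (- N) (min N (g n x))" for n x
  have N: "0 \<le> N"
    using bound[of 0] by linarith
  have h_cont: "continuous_on UNIV (h n)" for n
    unfolding h_def b_def by (intro continuous_intros g)
  have b_nonneg: "0 \<le> b x" if "x \<in> cell" for x
    using that by (simp add: b_def mem_box_cart)
  have h_bound: "\<bar>h n x\<bar> \<le> N" if "x \<in> cell" for n x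
  proof -
    have "\<bar>min 1 (real n * b x)\<bar> \<le> 1" "\<bar>max (- N) (min N (g n x))\<bar> \<le> N"
      using b_nonneg[OF that] N by auto
    then have "\<bar>min 1 (real n * b x)\<bar> * \<bar>max (- N) (min N (g n x))\<bar> \<le> 1 * N"
      by (intro mult_mono) auto
    then show ?thesis by (simp add: h_def abs_mult)
  qed
  have f_L2: "L2_cell f"
  proof (rule L2_cell_bound)
    show "(norm (f x))\<^sup>2 \<le> N\<^sup>2" for x
      using bound[of x] by (simp add: abs_le_square_iff[symmetric] N)
  qed (use f L2_cell_const[of N] in \<open>simp_all add: L2_cell_def\<close>)
  have h_L2: "L2_cell (h n)" for n
    by (rule L2_cell_continuous[OF h_cont])
  \<comment> \<open>The boundary of the cell is discarded along with \<open>Z\<close>, because the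
    cutoff vanishes there for every \<open>n\<close>.\<close>
  have "AE x in lebesgue_on cell. x \<notin> Z \<union> (cell - box 0 1)"
  proof -
    have "negligible (Z \<union> (cell - box 0 1))"
      using Z negligible_frontier_interval[of "0 :: plane" 1] by (simp add: negligible_Un)
    then have "AE x in lebesgue. x \<notin> Z \<union> (cell - box 0 1)"
      by (intro AE_not_in) (simp add: negligible_iff_null_sets)
    then show ?thesis
      by (subst AE_restrict_space_iff) auto
  qed
  then have "AE x in lebesgue_on cell. (\<lambda>n. (f x - h n x)\<^sup>2) \<longlonglongrightarrow> 0"
  proof (rule lebesgue_on_mono)
    fix x :: plane
    assume x: "x \<notin> Z \<union> (cell - box 0 1)" "x \<in> cell"
    have "0 < b x"
      using x by (simp add: b_def mem_box_cart)
    then have "eventually (\<lambda>n. 1 \<le> real n * b x) sequentially"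
      by real_asymp
    then have "eventually (\<lambda>n. max (- N) (min N (g n x)) = h n x) sequentially"
      by eventually_elim (simp add: h_def)
    moreover have "(\<lambda>n. max (- N) (min N (g n x))) \<longlonglongrightarrow> max (- N) (min N (f x))"
      using lim[of x] x by (intro tendsto_intros) auto
    moreover have "max (- N) (min N (f x)) = f x"
      using bound[of x] by auto
    ultimately have "(\<lambda>n. h n x) \<longlonglongrightarrow> f x"
      using Lim_transform_eventually by fastforce
    then have "(\<lambda>n. (f x - h n x)\<^sup>2) \<longlonglongrightarrow> (f x - f x)\<^sup>2"
      by (intro tendsto_intros)
    then show "(\<lambda>n. (f x - h n x)\<^sup>2) \<longlonglongrightarrow> 0"
      by simp
  qed
  then have "(\<lambda>n. LINT x|lebesgue_on cell. (f x - h n x)\<^sup>2) \<longlonglongrightarrow> (LINT x|lebesgue_on cell. 0)"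
  proof (intro integral_dominated_convergence)
    show "integrable (lebesgue_on cell) (\<lambda>x. (2 * N)\<^sup>2)"
      using L2_cell_integrable[OF L2_cell_const] .
    show "AE x in lebesgue_on cell. norm ((f x - h n x)\<^sup>2) \<le> (2 * N)\<^sup>2" for n
    proof (intro AE_I2)
      fix x
      assume "x \<in> space (lebesgue_on cell)"
      then have "\<bar>f x - h n x\<bar> \<le> \<bar>2 * N\<bar>"
        using h_bound[of x n] bound[of x] by auto
      then show "norm ((f x - h n x)\<^sup>2) \<le> (2 * N)\<^sup>2"
        unfolding abs_le_square_iff by simp
    qed
    show "(\<lambda>x. (f x - h n x)\<^sup>2) \<in> borel_measurable (lebesgue_on cell)" for n
      using f L2_cell_measurable[OF h_L2[of n]] by measurable
  qed simp_all
  then have "eventually (\<lambda>n. (LINT x|lebesgue_on cell. (f x - h n x)\<^sup>2) < e / 4) sequentially"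
    using \<open>e > 0\<close> by (intro order_tendstoD) auto
  then obtain n where n: "(LINT x|lebesgue_on cell. (f x - h n x)\<^sup>2) < e / 4"
    by (auto simp: eventually_sequentially)
  obtain p where p: "trig p" "\<And>x. x \<in> cell \<Longrightarrow> \<bar>h n x - p x\<bar> < sqrt (e / 4)"
  proof (rule trig_uniformly_dense[of "h n" "sqrt (e / 4)"])
    show "continuous_on cell (h n)"
      using h_cont continuous_on_subset by blast
    show "h n x = 0" if "x $ a \<in> {0, 1}" for x a
      using that exhaust_2[of a] by (auto simp: h_def b_def)
  qed (use \<open>e > 0\<close> in auto)
  have p_L2: "L2_cell p"
    by (intro L2_cell_continuous trig_continuous p)
  have "(LINT x|lebesgue_on cell. (h n x - p x)\<^sup>2) \<le> (LINT x|lebesgue_on cell. e / 4)"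
  proof (intro integral_mono)
    show "integrable (lebesgue_on cell) (\<lambda>x. (h n x - p x)\<^sup>2)"
      using L2_cell_diff[OF h_L2 p_L2] by (simp add: L2_cell_def)
    show "integrable (lebesgue_on cell) (\<lambda>x. e / 4)"
      using L2_cell_integrable[OF L2_cell_const] .
    show "(h n x - p x)\<^sup>2 \<le> e / 4" if "x \<in> space (lebesgue_on cell)" for x
    proof -
      have "\<bar>h n x - p x\<bar>\<^sup>2 \<le> (sqrt (e / 4))\<^sup>2"
        using p(2)[of x] that by (intro power_mono) auto
      then show ?thesis
        using \<open>e > 0\<close> by simp
    qed
  qed
  also have "\<dots> = e / 4"
    by (simp add: measure_cell)
  finally have "(LINT x|lebesgue_on cell. (h n x - p x)\<^sup>2) \<le> e / 4" .
  with n have "(LINT x|lebesgue_on cell. (f x - p x)\<^sup>2) < e"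
    using integral_power2_diff_le[OF f_L2 h_L2 p_L2, of n] by linarith
  with p(1) show thesis by (rule that)
qed

text \<open>Truncation at height \<open>n\<close> reduces to the bounded case: the squared error is
  dominated by \<open>(f x)\<^sup>2\<close> and is zero at \<open>x\<close> as soon as
  \<open>n\<close> exceeds \<open>\<bar>f x\<bar>\<close>.\<close>

lemma trig_dense_L2:
  fixes f :: "plane \<Rightarrow> real"
  assumes f: "L2_cell f" and "e > 0"
  obtains p where "trig p" "(LINT x|lebesgue_on cell. (f x - p x)\<^sup>2) < e"
proof -
  define h where "h n x = max (- real n) (min (real n) (f x))" for n x
  have f_meas: "f \<in> borel_measurable (lebesgue_on cell)"
    using f by (simp add: L2_cell_def)
  then have h_meas: "h n \<in> borel_measurable (lebesgue_on cell)" for n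
    unfolding h_def[abs_def] by simp
  have h_le: "(h n x)\<^sup>2 \<le> (f x)\<^sup>2" "(f x - h n x)\<^sup>2 \<le> (f x)\<^sup>2" for n x
    unfolding abs_le_square_iff[symmetric] by (auto simp: h_def)
  have f2: "integrable (lebesgue_on cell) (\<lambda>x. (f x)\<^sup>2)"
    using f by (simp add: L2_cell_def)
  have h_L2: "L2_cell (h n)" for n
    by (rule L2_cell_bound[OF h_meas f2]) (simp add: h_le)
  have "(\<lambda>n. LINT x|lebesgue_on cell. (f x - h n x)\<^sup>2) \<longlonglongrightarrow> (LINT x|lebesgue_on cell. 0)"
  proof (rule integral_dominated_convergence[OF _ _ f2])
    show "AE x in lebesgue_on cell. (\<lambda>n. (f x - h n x)\<^sup>2) \<longlonglongrightarrow> 0"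
    proof (intro AE_I2)
      fix x
      obtain k where k: "\<bar>f x\<bar> \<le> real k"
        using real_arch_simple by blast
      have "(f x - h n x)\<^sup>2 = 0" if "n \<ge> k" for n
      proof -
        have "\<bar>f x\<bar> \<le> real n"
          using k that by linarith
        then have "h n x = f x"
          unfolding h_def by linarith
        then show ?thesis by simp
      qed
      then show "(\<lambda>n. (f x - h n x)\<^sup>2) \<longlonglongrightarrow> 0"
        by (intro tendsto_eventually) (auto simp: eventually_sequentially)
    qed
  qed (use f_meas h_meas h_le in auto)
  then have "eventually (\<lambda>n. (LINT x|lebesgue_on cell. (f x - h n x)\<^sup>2) < e / 4) sequentially"
    using \<open>e > 0\<close> by (intro order_tendstoD) auto
  then obtain n where n: "(LINT x|lebesgue_on cell. (f x - h n x)\<^sup>2) < e / 4"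
    by (auto simp: eventually_sequentially)
  obtain p where p: "trig p" "(LINT x|lebesgue_on cell. (h n x - p x)\<^sup>2) < e / 4"
    by (rule trig_dense_L2_bounded[OF h_meas[of n], of "real n" "e / 4"])
      (use \<open>e > 0\<close> in \<open>auto simp: h_def\<close>)
  have "(LINT x|lebesgue_on cell. (f x - p x)\<^sup>2) < e"
    using n p(2) integral_power2_diff_le[OF f h_L2 L2_cell_continuous[OF trig_continuous[OF p(1)]], of n]
    by linarith
  with p(1) show thesis by (rule that)
qed

subsection \<open>Solenoidal and irrotational fields\<close>

lemma R_perp_mult: "R_perp *v v = vector [- v $ 2, v $ 1]"
  by (simp add: R_perp_def matrix_vector_mult_def vec_eq_iff forall_2 sum_2)

lemma R_perp_inner: "(R_perp *v v) \<bullet> w = - (v \<bullet> (R_perp *v w))" "(R_perp *v v) \<bullet> (R_perp *v w) = v \<bullet> w"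
  by (simp_all add: R_perp_mult inner_vec_def sum_2)

lemma linear_matrix_vector: "linear ((*v) M)" for M :: "real ^ 'n ^ 'm"
  by (rule matrix_vector_mul_linear)

lemma grad_trig_L2: "trig \<phi> \<Longrightarrow> L2_cell (grad \<phi>)"
  unfolding grad_def[abs_def]
  by (intro L2_cell_continuous continuous_on_vec_lambda trig_continuous trig_partial)

lemma integral_linear_L2:
  fixes f :: "plane \<Rightarrow> 'b::euclidean_space" and T :: "'b \<Rightarrow> 'c::euclidean_space"
  assumes "linear T" "L2_cell f"
  shows "(LINT x|lebesgue_on cell. T (f x)) = T (LINT x|lebesgue_on cell. f x)"
  using assms by (intro integral_bounded_linear L2_cell_integrable) (simp_all add: linear_conv_bounded_linear)

lemma integral_inner_const:
  fixes f :: "plane \<Rightarrow> 'b::euclidean_space"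
  assumes "L2_cell f"
  shows "(LINT x|lebesgue_on cell. c \<bullet> f x) = c \<bullet> (LINT x|lebesgue_on cell. f x)"
  using L2_cell_integrable[OF assms] by simp

lemma integral_grad_trig:
  assumes "trig \<phi>"
  shows "(LINT x|lebesgue_on cell. grad \<phi> x) = 0"
proof -
  have "(LINT x|lebesgue_on cell. grad \<phi> x) $ a = 0" for a
  proof -
    have "(LINT x|lebesgue_on cell. grad \<phi> x) $ a = (LINT x|lebesgue_on cell. grad \<phi> x $ a)"
      using integral_linear_L2[OF bounded_linear.linear[OF bounded_linear_vec_nth] grad_trig_L2[OF assms]]
      by metis
    then show ?thesis
      using integral_trig_partial[OF assms] by (simp add: grad_def)
  qed
  then show ?thesis
    by (simp add: vec_eq_iff)
qed

text \<open>Up to sign the integrand is a Jacobian determinant, a null Lagrangian: it is a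
  difference of derivatives of trigonometric polynomials, each with integral zero.\<close>

lemma integral_grad_rot_grad:
  assumes "trig \<phi>" "trig \<psi>"
  shows "(LINT x|lebesgue_on cell. grad \<phi> x \<bullet> (R_perp *v grad \<psi> x)) = 0"
proof -
  have "grad \<phi> x \<bullet> (R_perp *v grad \<psi> x) =
      partial 2 (\<lambda>x. \<phi> x * partial 1 \<psi> x) x - partial 1 (\<lambda>x. \<phi> x * partial 2 \<psi> x) x" for x
  proof -
    note [simp] = assms trig_differentiable trig_partial
    show ?thesis
      using fun_cong[OF trig_partial_commute[OF assms(2), of 1 2], of x]
      by (simp add: partial_mult R_perp_mult inner_vec_def sum_2 grad_def)
  qed
  moreover have "trig (\<lambda>x. \<phi> x * partial a \<psi> x)" for a
    using assms by (intro trig_mult trig_partial)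
  ultimately show ?thesis
    by (simp add: integral_trig_partial trig_integrable trig_partial)
qed

text \<open>Orthogonality to trigonometric gradients is the only form of divergence-freeness used
  below; the mean is unrestricted.\<close>

definition solenoidal :: "(plane \<Rightarrow> plane) \<Rightarrow> bool"
  where "solenoidal J \<longleftrightarrow> L2_cell J \<and>
    (\<forall>\<psi>. trig \<psi> \<longrightarrow> (LINT x|lebesgue_on cell. J x \<bullet> grad \<psi> x) = 0)"

text \<open>Curl-freeness is stated by duality rather than through a potential, so that
  \<open>R_perp\<close> exchanges it with \<open>solenoidal\<close>. Constant fields are
  included.\<close>

definition irrotational :: "(plane \<Rightarrow> plane) \<Rightarrow> bool"
  where "irrotational H \<longleftrightarrow> L2_cell H \<and>
    (\<forall>\<psi>. trig \<psi> \<longrightarrow> (LINT x|lebesgue_on cell. H x \<bullet> (R_perp *v grad \<psi> x)) = 0)"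

lemma rot_grad_trig_L2: "trig \<psi> \<Longrightarrow> L2_cell (\<lambda>x. R_perp *v grad \<psi> x)"
  by (rule L2_cell_linear[OF linear_matrix_vector grad_trig_L2])

lemma integral_rot_grad_trig: "trig \<psi> \<Longrightarrow> (LINT x|lebesgue_on cell. R_perp *v grad \<psi> x) = 0"
  by (simp add: integral_linear_L2[OF linear_matrix_vector] grad_trig_L2 integral_grad_trig)

text \<open>The defect \<open>r\<close> between the two sides is bounded by
  \<open>d * (C + 1)\<close> for every \<open>d > 0\<close>. Without its mean, \<open>J\<close> is
  orthogonal to constants and to gradients, so \<open>r\<close> sees only what remains of
  \<open>H\<close> after subtracting such fields, and density makes this remainder small.\<close>

lemma solenoidal_orthogonal_irrotational:
  assumes J: "solenoidal J" and H: "irrotational H"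
  shows "(LINT x|lebesgue_on cell. J x \<bullet> H x) =
    (LINT x|lebesgue_on cell. J x) \<bullet> (LINT x|lebesgue_on cell. H x)"
proof -
  have J2: "L2_cell J" and H2: "L2_cell H"
    using J H by (simp_all add: solenoidal_def irrotational_def)
  define m where "m = (LINT x|lebesgue_on cell. J x)"
  define J0 where "J0 x = J x - m" for x
  have J02: "L2_cell J0"
    unfolding J0_def by (intro L2_cell_diff J2 L2_cell_const)
  define C where "C = (LINT x|lebesgue_on cell. (norm (J0 x))\<^sup>2)"
  have C: "C \<ge> 0"
    unfolding C_def by simp
  define r where "r = (LINT x|lebesgue_on cell. J x \<bullet> H x) - m \<bullet> (LINT x|lebesgue_on cell. H x)"
  \<comment> \<open>Approximate \<open>H\<close> by a trigonometric field \<open>P\<close> and drop the rotated gradient part \<open>W\<close> of \<open>P\<close>: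
    since \<open>W\<close> is orthogonal to the remaining error \<open>D\<close>, this does not increase the error.\<close>
  have r_bound: "\<bar>r\<bar> \<le> d * (C + 1)" if d: "d > 0" for d
  proof -
    have comp: "L2_cell (\<lambda>x. H x $ a)" for a
      by (intro L2_cell_linear[OF _ H2] bounded_linear.linear bounded_linear_vec_nth)
    obtain p1 where p1: "trig p1" "(LINT x|lebesgue_on cell. (H x $ 1 - p1 x)\<^sup>2) < d\<^sup>2 / 2"
      by (rule trig_dense_L2[OF comp, of "d\<^sup>2 / 2" 1]) (use d in auto)
    obtain p2 where p2: "trig p2" "(LINT x|lebesgue_on cell. (H x $ 2 - p2 x)\<^sup>2) < d\<^sup>2 / 2"
      by (rule trig_dense_L2[OF comp, of "d\<^sup>2 / 2" 2]) (use d in auto)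
    obtain c1 \<phi>1 \<psi>1 where h1: "trig \<phi>1" "trig \<psi>1"
      "\<And>x. p1 x *\<^sub>R axis 1 1 = c1 + grad \<phi>1 x + R_perp *v grad \<psi>1 x"
      using trig_helmholtz_component[OF p1(1)] by blast
    obtain c2 \<phi>2 \<psi>2 where h2: "trig \<phi>2" "trig \<psi>2"
      "\<And>x. p2 x *\<^sub>R axis 2 1 = c2 + grad \<phi>2 x + R_perp *v grad \<psi>2 x"
      using trig_helmholtz_component[OF p2(1)] by blast
    define c \<phi> \<psi> where "c = c1 + c2" and "\<phi> = (\<lambda>x. \<phi>1 x + \<phi>2 x)" and "\<psi> = (\<lambda>x. \<psi>1 x + \<psi>2 x)"
    have \<phi>: "trig \<phi>" and \<psi>: "trig \<psi>"
      unfolding \<phi>_def \<psi>_def using h1 h2 by (auto intro: trig.add)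
    define W where "W x = R_perp *v grad \<psi> x" for x
    define D where "D x = H x - (c + grad \<phi> x)" for x
    have W2: "L2_cell W" and D2: "L2_cell D"
      unfolding W_def D_def by (intro rot_grad_trig_L2 \<psi> L2_cell_diff H2 L2_cell_add L2_cell_const grad_trig_L2 \<phi>)+
    \<comment> \<open>\<open>D x - W x\<close> is \<open>H x\<close> minus the full trigonometric
      field; its squared norm is expanded.\<close>
    have HP: "(H x $ 1 - p1 x)\<^sup>2 + (H x $ 2 - p2 x)\<^sup>2 = (norm (D x))\<^sup>2 - 2 * (D x \<bullet> W x) + (norm (W x))\<^sup>2" for x
    proof -
      have "grad \<phi> x = grad \<phi>1 x + grad \<phi>2 x" "grad \<psi> x = grad \<psi>1 x + grad \<psi>2 x"
        using h1(1,2) h2(1,2) by (simp_all add: \<phi>_def \<psi>_def grad_def trig_partial_simps vec_eq_iff)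
      then have "p1 x *\<^sub>R axis 1 1 + p2 x *\<^sub>R axis 2 1 = c + grad \<phi> x + W x"
        unfolding h1(3) h2(3) by (simp add: c_def W_def matrix_vector_right_distrib)
      moreover have "p1 x *\<^sub>R axis 1 1 + p2 x *\<^sub>R axis 2 1 = (vector [p1 x, p2 x] :: plane)"
        by (simp add: vec_eq_iff forall_2 axis_def)
      ultimately have "D x - W x = H x - vector [p1 x, p2 x]"
        unfolding D_def by (metis diff_diff_eq)
      then have "(norm (D x - W x))\<^sup>2 = (H x $ 1 - p1 x)\<^sup>2 + (H x $ 2 - p2 x)\<^sup>2"
        unfolding power2_norm_eq_inner by (simp add: inner_vec_def sum_2 power2_eq_square)
      moreover have "(norm (D x - W x))\<^sup>2 = (norm (D x))\<^sup>2 - 2 * (D x \<bullet> W x) + (norm (W x))\<^sup>2"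
        by (simp add: power2_norm_eq_inner inner_diff_left inner_diff_right inner_commute)
      ultimately show ?thesis by simp
    qed
    \<comment> \<open>Against \<open>W\<close>, the field \<open>H\<close> gives zero by assumption,
      the constant because \<open>W\<close> has mean zero, and the gradient by the Jacobian
      identity.\<close>
    have DW: "(LINT x|lebesgue_on cell. D x \<bullet> W x) = 0"
    proof -
      note int = L2_cell_integrable_inner[OF H2 W2] L2_cell_integrable_inner[OF L2_cell_const W2, of c]
        L2_cell_integrable_inner[OF grad_trig_L2[OF \<phi>] W2]
      have "(LINT x|lebesgue_on cell. D x \<bullet> W x) = (LINT x|lebesgue_on cell. H x \<bullet> W x) -
          ((LINT x|lebesgue_on cell. c \<bullet> W x) + (LINT x|lebesgue_on cell. grad \<phi> x \<bullet> W x))"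
        unfolding D_def inner_diff_left inner_add_left using int by simp
      moreover have "(LINT x|lebesgue_on cell. c \<bullet> W x) = 0"
        unfolding integral_inner_const[OF W2] by (simp add: W_def[abs_def] integral_rot_grad_trig \<psi>)
      moreover have "(LINT x|lebesgue_on cell. H x \<bullet> W x) = 0"
        using H \<psi> by (simp add: irrotational_def W_def)
      moreover have "(LINT x|lebesgue_on cell. grad \<phi> x \<bullet> W x) = 0"
        unfolding W_def by (rule integral_grad_rot_grad[OF \<phi> \<psi>])
      ultimately show ?thesis by simp
    qed
    note int = L2_cell_integrable_power2[OF D2] L2_cell_integrable_power2[OF W2]
      L2_cell_integrable_inner[OF D2 W2]
    have "(LINT x|lebesgue_on cell. (norm (D x))\<^sup>2) \<le>
        (LINT x|lebesgue_on cell. (norm (D x))\<^sup>2) + (LINT x|lebesgue_on cell. (norm (W x))\<^sup>2)"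
      by simp
    also have "\<dots> = (LINT x|lebesgue_on cell. (norm (D x))\<^sup>2 - 2 * (D x \<bullet> W x) + (norm (W x))\<^sup>2)"
      using int by (simp add: DW)
    also have "\<dots> = (LINT x|lebesgue_on cell. (H x $ 1 - p1 x)\<^sup>2) + (LINT x|lebesgue_on cell. (H x $ 2 - p2 x)\<^sup>2)"
      unfolding HP[symmetric]
      by (intro Bochner_Integration.integral_add L2_cell_integrable_power2_diff comp
          L2_cell_continuous trig_continuous p1 p2)
    finally have D_small: "(LINT x|lebesgue_on cell. (norm (D x))\<^sup>2) \<le> d\<^sup>2"
      using p1(2) p2(2) by linarith
    \<comment> \<open>\<open>J0\<close> annihilates both \<open>c\<close> and
      \<open>grad \<phi>\<close>, so \<open>H\<close> may be replaced by \<open>D\<close>.\<close>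
    have r: "r = (LINT x|lebesgue_on cell. J0 x \<bullet> D x)"
    proof -
      note G2 = grad_trig_L2[OF \<phi>]
      note int = L2_cell_integrable_inner[OF J2 H2] L2_cell_integrable_inner[OF J2 L2_cell_const, of c]
        L2_cell_integrable_inner[OF J2 G2] L2_cell_integrable_inner[OF L2_cell_const H2, of m]
        L2_cell_integrable_inner[OF L2_cell_const G2, of m]
      have "(LINT x|lebesgue_on cell. J0 x \<bullet> D x) =
          (LINT x|lebesgue_on cell. (J x \<bullet> H x - (J x \<bullet> c + J x \<bullet> grad \<phi> x)) -
             (m \<bullet> H x - (m \<bullet> c + m \<bullet> grad \<phi> x)))"
        by (simp add: J0_def D_def inner_diff_left inner_diff_right inner_add_right algebra_simps)
      also have "\<dots> = ((LINT x|lebesgue_on cell. J x \<bullet> H x) -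
          ((LINT x|lebesgue_on cell. J x \<bullet> c) + (LINT x|lebesgue_on cell. J x \<bullet> grad \<phi> x))) -
          ((LINT x|lebesgue_on cell. m \<bullet> H x) - (m \<bullet> c + (LINT x|lebesgue_on cell. m \<bullet> grad \<phi> x)))"
        using int L2_cell_integrable[OF L2_cell_const, of "m \<bullet> c"]
        by (simp add: measure_cell)
      also have "(LINT x|lebesgue_on cell. J x \<bullet> c) = m \<bullet> c"
        using integral_inner_const[OF J2, of c] by (simp add: inner_commute m_def)
      also have "(LINT x|lebesgue_on cell. J x \<bullet> grad \<phi> x) = 0"
        using J \<phi> by (simp add: solenoidal_def)
      also have "(LINT x|lebesgue_on cell. m \<bullet> grad \<phi> x) = 0"
        unfolding integral_inner_const[OF G2] by (simp add: integral_grad_trig \<phi>)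
      also have "(LINT x|lebesgue_on cell. m \<bullet> H x) = m \<bullet> (LINT x|lebesgue_on cell. H x)"
        by (rule integral_inner_const[OF H2])
      finally show ?thesis
        by (simp add: r_def)
    qed
    have "\<bar>r\<bar> \<le> (LINT x|lebesgue_on cell. \<bar>J0 x \<bullet> D x\<bar>)"
      unfolding r by (rule integral_abs_bound)
    \<comment> \<open>Young's inequality with weight \<open>d\<close>: since the squared norm of
      \<open>D\<close> integrates to at most \<open>d\<^sup>2\<close>, both terms end up
      proportional to \<open>d\<close>.\<close>
    also have "\<dots> \<le> (LINT x|lebesgue_on cell. d * (norm (J0 x))\<^sup>2 + (norm (D x))\<^sup>2 / d)"
    proof (intro integral_mono)
      fix x
      have "\<bar>J0 x \<bullet> D x\<bar> \<le> norm (J0 x) * norm (D x)"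
        by (rule Cauchy_Schwarz_ineq2)
      also have "\<dots> \<le> d * (norm (J0 x))\<^sup>2 + (norm (D x))\<^sup>2 / d"
      proof -
        have "2 * (d * norm (J0 x)) * norm (D x) \<le> (d * norm (J0 x))\<^sup>2 + (norm (D x))\<^sup>2"
          by (rule sum_squares_bound)
        moreover have "0 \<le> d * norm (J0 x) * norm (D x)"
          using d by simp
        moreover have "d * (d * (norm (J0 x))\<^sup>2 + (norm (D x))\<^sup>2 / d) = (d * norm (J0 x))\<^sup>2 + (norm (D x))\<^sup>2"
          using d by (simp add: power2_eq_square field_simps)
        ultimately have "d * (norm (J0 x) * norm (D x)) \<le> d * (d * (norm (J0 x))\<^sup>2 + (norm (D x))\<^sup>2 / d)"
          by linarith
        then show ?thesis
          using d by (simp only: mult_le_cancel_left_pos)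
      qed
      finally show "\<bar>J0 x \<bullet> D x\<bar> \<le> d * (norm (J0 x))\<^sup>2 + (norm (D x))\<^sup>2 / d" .
    qed (use L2_cell_integrable_inner[OF J02 D2] L2_cell_integrable_power2[OF J02] int(1) in auto)
    also have "\<dots> = d * C + (LINT x|lebesgue_on cell. (norm (D x))\<^sup>2) / d"
      using L2_cell_integrable_power2[OF J02] int(1) by (simp add: C_def)
    also have "\<dots> \<le> d * C + d\<^sup>2 / d"
      using D_small d by (intro add_left_mono divide_right_mono) auto
    also have "\<dots> = d * (C + 1)"
      using d by (simp add: power2_eq_square distrib_left)
    finally show ?thesis .
  qed
  have "r = 0"
  proof (rule ccontr)
    assume "r \<noteq> 0"
    \<comment> \<open>The choice \<open>d = \<bar>r\<bar> / (2 * (C + 1))\<close> halves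
      \<open>\<bar>r\<bar>\<close>; \<open>C + 1\<close> is positive even when \<open>C\<close> is
      zero.\<close>
    then have "\<bar>r\<bar> \<le> \<bar>r\<bar> / (2 * (C + 1)) * (C + 1)"
      using C by (intro r_bound) simp
    also have "\<dots> = \<bar>r\<bar> / 2"
      using C by (simp add: field_simps)
    finally show False
      using \<open>r \<noteq> 0\<close> by simp
  qed
  then show ?thesis
    by (simp add: r_def m_def)
qed

section \<open>From the weak formulations to solenoidal and irrotational fields\<close>

lemma periodic_div_free_solenoidal: "periodic_div_free J \<Longrightarrow> solenoidal J"
  by (simp add: periodic_div_free_def solenoidal_def trig_smooth_periodic)

text \<open>Derivatives of \<open>\<psi>\<close> serve as test functions in the weak gradient
  identity; this leaves \<open>\<phi>\<close> against two mixed second derivatives, which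
  cancel.\<close>

lemma periodic_weak_grad_irrotational:
  assumes "periodic_weak_grad \<phi> g"
  shows "irrotational g"
  unfolding irrotational_def
proof (intro conjI allI impI)
  show g2: "L2_cell g"
    using assms by (simp add: periodic_weak_grad_def)
  fix \<psi> assume \<psi>: "trig \<psi>"
  have p2: "L2_cell (partial a \<psi>)" for a
    by (intro L2_cell_continuous trig_continuous trig_partial \<psi>)
  have comp: "L2_cell (\<lambda>x. g x $ a)" for a
    by (intro L2_cell_linear[OF _ g2] bounded_linear.linear bounded_linear_vec_nth)
  have int: "integrable (lebesgue_on cell) (\<lambda>x. g x $ a * partial b \<psi> x)" for a b
    using L2_cell_integrable_inner[OF comp p2] by simp
  have weak: "(LINT x|lebesgue_on cell. g x $ a * partial b \<psi> x) =
      - (LINT x|lebesgue_on cell. \<phi> x * partial a (partial b \<psi>) x)" for a b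
    using assms trig_smooth_periodic[OF trig_partial[OF \<psi>]] by (simp add: periodic_weak_grad_def)
  have "(LINT x|lebesgue_on cell. g x \<bullet> (R_perp *v grad \<psi> x)) =
      (LINT x|lebesgue_on cell. g x $ 2 * partial 1 \<psi> x - g x $ 1 * partial 2 \<psi> x)"
    by (simp add: R_perp_mult inner_vec_def sum_2 grad_def)
  also have "\<dots> = 0"
    using int by (simp add: weak trig_partial_commute[OF \<psi>, of 2 1])
  finally show "(LINT x|lebesgue_on cell. g x \<bullet> (R_perp *v grad \<psi> x)) = 0" .
qed

text \<open>The constant 1 is a periodic test function with zero derivatives.\<close>

lemma periodic_weak_grad_integral:
  assumes "periodic_weak_grad \<phi> g"
  shows "(LINT x|lebesgue_on cell. g x) = 0"
proof -
  have g2: "L2_cell g"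
    using assms by (simp add: periodic_weak_grad_def)
  have "partial a (\<lambda>x. 1 :: real) = (\<lambda>x. 0)" for a
    by (simp add: partial_def fun_eq_iff)
  then have "(LINT x|lebesgue_on cell. g x $ a) = 0" for a
    using assms trig_smooth_periodic[OF trig_const[of 1]]
    by (fastforce simp: periodic_weak_grad_def)
  then have "(LINT x|lebesgue_on cell. g x) $ a = 0" for a
    using integral_linear_L2[OF bounded_linear.linear[OF bounded_linear_vec_nth] g2]
    by metis
  then show ?thesis
    by (simp add: vec_eq_iff)
qed

lemma irrotational_const: "irrotational (\<lambda>x. c)"
  unfolding irrotational_def
  by (simp add: L2_cell_const integral_inner_const rot_grad_trig_L2 integral_rot_grad_trig)

text \<open>Skewness of \<open>R_perp\<close> moves the rotation onto the test gradient; for the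
  reverse passage the isometry property removes it.\<close>

lemma solenoidal_rot: "irrotational H \<Longrightarrow> solenoidal (\<lambda>x. R_perp *v H x)"
  by (simp add: irrotational_def solenoidal_def L2_cell_linear linear_matrix_vector R_perp_inner)

lemma irrotational_rot: "solenoidal J \<Longrightarrow> irrotational (\<lambda>x. R_perp *v J x)"
  by (simp add: irrotational_def solenoidal_def L2_cell_linear linear_matrix_vector R_perp_inner(2))

lemma solenoidal_lincomb:
  assumes "solenoidal J" "solenoidal J'"
  shows "solenoidal (\<lambda>x. a *\<^sub>R J x + b *\<^sub>R J' x)"
  unfolding solenoidal_def
proof (intro conjI allI impI)
  show "L2_cell (\<lambda>x. a *\<^sub>R J x + b *\<^sub>R J' x)"
    using assms unfolding solenoidal_def
    by (intro L2_cell_add L2_cell_linear[OF linear_scaleR]) simp_all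
  fix \<psi> assume "trig \<psi>"
  with assms show "(LINT x|lebesgue_on cell. (a *\<^sub>R J x + b *\<^sub>R J' x) \<bullet> grad \<psi> x) = 0"
    by (simp add: solenoidal_def inner_add_left L2_cell_integrable_inner grad_trig_L2)
qed

lemma irrotational_lincomb:
  assumes "irrotational H" "irrotational H'"
  shows "irrotational (\<lambda>x. a *\<^sub>R H x + b *\<^sub>R H' x)"
  unfolding irrotational_def
proof (intro conjI allI impI)
  show "L2_cell (\<lambda>x. a *\<^sub>R H x + b *\<^sub>R H' x)"
    using assms unfolding irrotational_def
    by (intro L2_cell_add L2_cell_linear[OF linear_scaleR]) simp_all
  fix \<psi> assume "trig \<psi>"
  with assms show "(LINT x|lebesgue_on cell. (a *\<^sub>R H x + b *\<^sub>R H' x) \<bullet> (R_perp *v grad \<psi> x)) = 0"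
    by (simp add: irrotational_def inner_add_left L2_cell_integrable_inner rot_grad_trig_L2)
qed

text \<open>The cell problem prescribes its fields only on the cell, so everything has to be
  insensitive to values outside.\<close>

lemma L2_cell_cong:
  fixes f g :: "plane \<Rightarrow> 'b::euclidean_space"
  assumes "\<And>x. x \<in> cell \<Longrightarrow> f x = g x"
  shows "L2_cell f \<longleftrightarrow> L2_cell g"
proof -
  have "f \<in> borel_measurable (lebesgue_on cell) \<longleftrightarrow> g \<in> borel_measurable (lebesgue_on cell)"
    by (rule measurable_cong) (simp add: assms)
  moreover have "integrable (lebesgue_on cell) (\<lambda>x. (norm (f x))\<^sup>2) \<longleftrightarrow>
      integrable (lebesgue_on cell) (\<lambda>x. (norm (g x))\<^sup>2)"
    by (rule Bochner_Integration.integrable_cong) (simp_all add: assms)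
  ultimately show ?thesis
    by (simp add: L2_cell_def)
qed

lemma integral_cell_cong:
  assumes "\<And>x. x \<in> cell \<Longrightarrow> f x = g x"
  shows "(LINT x|lebesgue_on cell. f x) = (LINT x|lebesgue_on cell. g x)"
  by (rule Bochner_Integration.integral_cong) (simp_all add: assms)

lemma irrotational_cong:
  assumes "\<And>x. x \<in> cell \<Longrightarrow> f x = g x"
  shows "irrotational f \<longleftrightarrow> irrotational g"
proof -
  have "(LINT x|lebesgue_on cell. f x \<bullet> (R_perp *v grad \<psi> x)) =
      (LINT x|lebesgue_on cell. g x \<bullet> (R_perp *v grad \<psi> x))" for \<psi>
    by (rule integral_cell_cong) (simp add: assms)
  then show ?thesis
    using L2_cell_cong[OF assms] by (simp add: irrotational_def)
qed

subsection \<open>Duality for block fields\<close>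

definition solenoidal2 :: "(plane \<Rightarrow> field2) \<Rightarrow> bool"
  where "solenoidal2 J \<longleftrightarrow> (\<forall>i. solenoidal (\<lambda>x. part (J x) i))"

definition irrotational2 :: "(plane \<Rightarrow> field2) \<Rightarrow> bool"
  where "irrotational2 H \<longleftrightarrow> (\<forall>i. irrotational (\<lambda>x. part (H x) i))"

lemma part_linear: "linear (\<lambda>E. part E i)"
  by (rule linearI) (simp_all add: part_def vec_eq_iff)

lemma sum_field_index: "(\<Sum>p\<in>UNIV. f p) = (\<Sum>i\<in>UNIV. \<Sum>a\<in>UNIV. f (i, a))"
  for f :: "2 \<times> 2 \<Rightarrow> real"
  by (simp add: sum.cartesian_product)

lemma inner_part: "E \<bullet> F = part E 1 \<bullet> part F 1 + part E 2 \<bullet> part F 2"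
  unfolding inner_vec_def sum_field_index by (simp add: part_def sum_2)

lemma part_kron: "part ((P \<otimes>\<^sub>K Q) *v E) i =
    P $ i $ 1 *\<^sub>R (Q *v part E 1) + P $ i $ 2 *\<^sub>R (Q *v part E 2)"
  unfolding matrix_vector_mult_def vec_eq_iff part_def kron_def sum_field_index
  by (simp add: sum_2 algebra_simps)

lemma L2_cell_parts:
  assumes "\<And>i. L2_cell (\<lambda>x. part (E x) i)"
  shows "L2_cell E"
proof -
  define emb :: "2 \<Rightarrow> plane \<Rightarrow> field2" where "emb i v = (\<chi> p. if fst p = i then v $ snd p else 0)" for i v
  have "linear (emb i)" for i
    by (rule linearI) (simp_all add: emb_def vec_eq_iff)
  then have "L2_cell (\<lambda>x. emb 1 (part (E x) 1) + emb 2 (part (E x) 2))"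
    by (intro L2_cell_add L2_cell_linear[OF _ assms])
  moreover have "emb 1 (part F 1) + emb 2 (part F 2) = F" for F
    using exhaust_2 by (auto simp: emb_def part_def vec_eq_iff)
  ultimately show ?thesis by simp
qed

lemma solenoidal2_L2: "solenoidal2 J \<Longrightarrow> L2_cell J"
  by (intro L2_cell_parts) (simp add: solenoidal2_def solenoidal_def)

lemma irrotational2_L2: "irrotational2 H \<Longrightarrow> L2_cell H"
  by (intro L2_cell_parts) (simp add: irrotational2_def irrotational_def)

lemma solenoidal2_orthogonal_irrotational2:
  assumes J: "solenoidal2 J" and H: "irrotational2 H"
  shows "(LINT x|lebesgue_on cell. J x \<bullet> H x) =
    (LINT x|lebesgue_on cell. J x) \<bullet> (LINT x|lebesgue_on cell. H x)"
proof -
  have J': "solenoidal (\<lambda>x. part (J x) i)" and H': "irrotational (\<lambda>x. part (H x) i)" for i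
    using assms by (simp_all add: solenoidal2_def irrotational2_def)
  have "integrable (lebesgue_on cell) (\<lambda>x. part (J x) i \<bullet> part (H x) i)" for i
    using J' H' by (intro L2_cell_integrable_inner) (simp_all add: solenoidal_def irrotational_def)
  then have "(LINT x|lebesgue_on cell. J x \<bullet> H x) =
      (LINT x|lebesgue_on cell. part (J x) 1 \<bullet> part (H x) 1) +
      (LINT x|lebesgue_on cell. part (J x) 2 \<bullet> part (H x) 2)"
    by (simp add: inner_part)
  also have "\<dots> = (LINT x|lebesgue_on cell. J x) \<bullet> (LINT x|lebesgue_on cell. H x)"
    unfolding solenoidal_orthogonal_irrotational[OF J' H']
      integral_linear_L2[OF part_linear solenoidal2_L2[OF J]]
      integral_linear_L2[OF part_linear irrotational2_L2[OF H]]
    by (simp add: inner_part)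
  finally show ?thesis .
qed

text \<open>The left factor only mixes the two plane fields linearly, which preserves curl-freeness,
  while \<open>R_perp\<close> rotates each of them.\<close>

lemma solenoidal2_kron_R_perp: "irrotational2 H \<Longrightarrow> solenoidal2 (\<lambda>x. (P \<otimes>\<^sub>K R_perp) *v H x)"
  unfolding irrotational2_def solenoidal2_def part_kron
  by (intro allI solenoidal_lincomb solenoidal_rot) simp_all

lemma irrotational2_kron_R_perp: "solenoidal2 J \<Longrightarrow> irrotational2 (\<lambda>x. (P \<otimes>\<^sub>K R_perp) *v J x)"
  unfolding irrotational2_def solenoidal2_def part_kron
  by (intro allI irrotational_lincomb irrotational_rot) simp_all

lemma solenoidal2_lincomb:
  assumes "solenoidal2 J" "solenoidal2 J'"
  shows "solenoidal2 (\<lambda>x. a *\<^sub>R J x + b *\<^sub>R J' x)"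
proof -
  have "part (a *\<^sub>R E + b *\<^sub>R F) i = a *\<^sub>R part E i + b *\<^sub>R part F i" for E F i
    by (simp add: part_def vec_eq_iff)
  then show ?thesis
    using assms solenoidal_lincomb by (simp add: solenoidal2_def)
qed

text \<open>Extracts all that is used later about a solution of the cell problem.\<close>

lemma cell_solution_fields:
  assumes "cell_solution L E\<^sub>0 E"
  shows "irrotational2 E" "(LINT x|lebesgue_on cell. E x) = E\<^sub>0" "solenoidal2 (\<lambda>x. L x *v E x)"
proof -
  obtain \<phi>\<^sub>1 \<phi>\<^sub>2 g\<^sub>1 g\<^sub>2 where g: "periodic_weak_grad \<phi>\<^sub>1 g\<^sub>1" "periodic_weak_grad \<phi>\<^sub>2 g\<^sub>2"
    and E: "\<And>x. x \<in> cell \<Longrightarrow> part (E x) 1 = part E\<^sub>0 1 + g\<^sub>1 x"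
      "\<And>x. x \<in> cell \<Longrightarrow> part (E x) 2 = part E\<^sub>0 2 + g\<^sub>2 x"
    using assms unfolding cell_solution_def by blast
  \<comment> \<open>The two potentials are gathered into a family indexed by \<open>i\<close>, so
    that both components are treated at once.\<close>
  have "\<exists>\<phi> h. periodic_weak_grad \<phi> h \<and> (\<forall>x\<in>cell. part (E x) i = part E\<^sub>0 i + h x)" for i
    using exhaust_2[of i] g E by blast
  then obtain \<phi> h where h: "\<And>i. periodic_weak_grad (\<phi> i) (h i)"
    and Eh: "\<And>i x. x \<in> cell \<Longrightarrow> part (E x) i = part E\<^sub>0 i + h i x"
    by metis
  show irr: "irrotational2 E"
    unfolding irrotational2_def
  proof
    fix i
    have "irrotational (\<lambda>x. 1 *\<^sub>R part E\<^sub>0 i + 1 *\<^sub>R h i x)"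
      by (intro irrotational_lincomb irrotational_const periodic_weak_grad_irrotational[OF h])
    then show "irrotational (\<lambda>x. part (E x) i)"
      using irrotational_cong[of "\<lambda>x. part (E x) i" "\<lambda>x. part E\<^sub>0 i + h i x"] Eh by simp
  qed
  have mean: "part (LINT x|lebesgue_on cell. E x) i = part E\<^sub>0 i" for i
  proof -
    have "L2_cell (h i)"
      using h[of i] by (simp add: periodic_weak_grad_def)
    have "part (LINT x|lebesgue_on cell. E x) i = (LINT x|lebesgue_on cell. part (E x) i)"
      using integral_linear_L2[OF part_linear irrotational2_L2[OF irr]] by simp
    also have "\<dots> = (LINT x|lebesgue_on cell. part E\<^sub>0 i + h i x)"
      by (rule integral_cell_cong) (simp add: Eh)
    also have "\<dots> = part E\<^sub>0 i"
      using L2_cell_integrable[OF \<open>L2_cell (h i)\<close>] L2_cell_integrable[OF L2_cell_const, of "part E\<^sub>0 i"]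
        periodic_weak_grad_integral[OF h[of i]]
      by (simp add: measure_cell)
    finally show ?thesis .
  qed
  then show "(LINT x|lebesgue_on cell. E x) = E\<^sub>0"
    by (auto simp: vec_eq_iff part_def)
  show "solenoidal2 (\<lambda>x. L x *v E x)"
    using assms by (simp add: cell_solution_def solenoidal2_def periodic_div_free_solenoidal)
qed

lemma transpose_adjoint: "(M *v x) \<bullet> y = x \<bullet> (transpose M *v y)" for M :: "real ^ 'n ^ 'm"
proof -
  have "x \<bullet> (y v* M) = y \<bullet> (M *v x)"
    using dot_lmul_matrix[of y M x] by (simp add: inner_commute)
  then show ?thesis
    by (simp add: inner_commute)
qed

lemma transpose_T_perp: "transpose T_perp = T_perp"
  by (simp add: T_perp_def kron_def R_perp_def transpose_def vec_eq_iff forall_2)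

text \<open>Each bilinear form in the means \<open>u\<close>, \<open>v\<close> is written as an
  integral over the cell by orthogonality of solenoidal and irrotational fields. The phase relation
  is then applied pointwise under the integral.\<close>

lemma effective_tensor_kron_relation:
  fixes L :: "plane \<Rightarrow> tensor" and L_eff :: tensor
  assumes eff: "L has_effective_tensor L_eff"
    and sym: "\<And>x. x \<in> cell \<Longrightarrow> transpose (L x) = L x"
    and rel: "\<And>x. x \<in> cell \<Longrightarrow>
      (L x + A *\<^sub>R T_perp) ** (P \<otimes>\<^sub>K R_perp) ** (L x + A *\<^sub>R T_perp) = b *\<^sub>R (Q \<otimes>\<^sub>K R_perp)"
  shows "(L_eff + A *\<^sub>R T_perp) ** (P \<otimes>\<^sub>K R_perp) ** (L_eff + A *\<^sub>R T_perp) = b *\<^sub>R (Q \<otimes>\<^sub>K R_perp)"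
proof -
  define L' where "L' x = L x + A *\<^sub>R T_perp" for x
  define M where "M = L_eff + A *\<^sub>R T_perp"
  define K where "K = P \<otimes>\<^sub>K R_perp"
  define N where "N = Q \<otimes>\<^sub>K R_perp"
  have "transpose (L' x) = L' x" if "x \<in> cell" for x
    using sym[OF that] transpose_T_perp by (simp add: L'_def transpose_def vec_eq_iff)
  then have sym': "(L' x *v u) \<bullet> v = u \<bullet> (L' x *v v)" if "x \<in> cell" for x u v
    using that transpose_adjoint by metis
  have rel': "L' x *v (K *v (L' x *v u)) = b *\<^sub>R (N *v u)" if "x \<in> cell" for x u
    using arg_cong[OF rel[OF that], of "\<lambda>X. X *v u"]
    by (simp add: L'_def K_def N_def matrix_vector_mul_assoc matrix_mul_assoc scaleR_matrix_vector_assoc)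
  \<comment> \<open>The same field \<open>E\<close> serves for \<open>L\<close> and for
    \<open>L'\<close>: \<open>T_perp *v E x\<close> is solenoidal because \<open>E\<close> is
    irrotational, and its mean is \<open>T_perp *v E\<^sub>0\<close>.\<close>
  have "\<forall>E\<^sub>0. \<exists>E. irrotational2 E \<and> (LINT x|lebesgue_on cell. E x) = E\<^sub>0 \<and>
      solenoidal2 (\<lambda>x. L' x *v E x) \<and> (LINT x|lebesgue_on cell. L' x *v E x) = M *v E\<^sub>0"
  proof
    fix E\<^sub>0
    obtain E where E: "cell_solution L E\<^sub>0 E" "L_eff *v E\<^sub>0 = (LINT x|lebesgue_on cell. L x *v E x)"
      using eff unfolding has_effective_tensor_def by blast
    note F = cell_solution_fields[OF E(1)]
    have T: "solenoidal2 (\<lambda>x. T_perp *v E x)"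
      unfolding T_perp_def by (rule solenoidal2_kron_R_perp[OF F(1)])
    have eq: "L' x *v u = 1 *\<^sub>R (L x *v u) + A *\<^sub>R (T_perp *v u)" for x u
      by (simp add: L'_def matrix_vector_mult_add_rdistrib scaleR_matrix_vector_assoc)
    have "solenoidal2 (\<lambda>x. L' x *v E x)"
      unfolding eq by (rule solenoidal2_lincomb[OF F(3) T])
    moreover have "(LINT x|lebesgue_on cell. L' x *v E x) = L_eff *v E\<^sub>0 + A *\<^sub>R (T_perp *v E\<^sub>0)"
      unfolding eq
      using L2_cell_integrable[OF solenoidal2_L2[OF F(3)]] L2_cell_integrable[OF solenoidal2_L2[OF T]]
        integral_linear_L2[OF linear_matrix_vector irrotational2_L2[OF F(1)], of T_perp]
      by (simp add: E(2) F(2))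
    moreover have "M *v E\<^sub>0 = L_eff *v E\<^sub>0 + A *\<^sub>R (T_perp *v E\<^sub>0)"
      by (simp add: M_def matrix_vector_mult_add_rdistrib scaleR_matrix_vector_assoc)
    ultimately show "\<exists>E. irrotational2 E \<and> (LINT x|lebesgue_on cell. E x) = E\<^sub>0 \<and>
      solenoidal2 (\<lambda>x. L' x *v E x) \<and> (LINT x|lebesgue_on cell. L' x *v E x) = M *v E\<^sub>0"
      using F(1,2) by (intro exI[of _ E]) simp
  qed
  from choice[OF this] obtain \<E> where \<E>: "\<And>e. irrotational2 (\<E> e)" "\<And>e. (LINT x|lebesgue_on cell. \<E> e x) = e"
    "\<And>e. solenoidal2 (\<lambda>x. L' x *v \<E> e x)" "\<And>e. (LINT x|lebesgue_on cell. L' x *v \<E> e x) = M *v e"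
    by blast
  \<comment> \<open>Both sides equal the symmetric energy form of the solutions with means
    \<open>u\<close> and \<open>v\<close>.\<close>
  have M_sym: "(M *v u) \<bullet> v = u \<bullet> (M *v v)" for u v
  proof -
    have "(M *v u) \<bullet> v = (LINT x|lebesgue_on cell. (L' x *v \<E> u x) \<bullet> \<E> v x)"
      using solenoidal2_orthogonal_irrotational2[OF \<E>(3,1), of u v] by (simp add: \<E>)
    also have "\<dots> = (LINT x|lebesgue_on cell. (L' x *v \<E> v x) \<bullet> \<E> u x)"
      by (rule integral_cell_cong) (simp add: sym' inner_commute[of "\<E> u _"])
    also have "\<dots> = u \<bullet> (M *v v)"
      using solenoidal2_orthogonal_irrotational2[OF \<E>(3,1), of v u] by (simp add: \<E> inner_commute[of u])
    finally show ?thesis .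
  qed
  \<comment> \<open>Duality: \<open>K L' E\<close> is again curl free, with divergence free flux \<open>L' K L' E = b N E\<close>.\<close>
  have "(M ** K ** M) *v u = (b *\<^sub>R N) *v u" for u
  proof -
    have KE: "irrotational2 (\<lambda>x. K *v (L' x *v \<E> u x))"
      unfolding K_def by (rule irrotational2_kron_R_perp[OF \<E>(3)])
    have NE: "solenoidal2 (\<lambda>x. N *v \<E> u x)"
      unfolding N_def by (rule solenoidal2_kron_R_perp[OF \<E>(1)])
    have KE_mean: "(LINT x|lebesgue_on cell. K *v (L' x *v \<E> u x)) = K *v (M *v u)"
      using integral_linear_L2[OF linear_matrix_vector solenoidal2_L2[OF \<E>(3)]] by (simp add: \<E>)
    have NE_mean: "(LINT x|lebesgue_on cell. N *v \<E> u x) = N *v u"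
      using integral_linear_L2[OF linear_matrix_vector irrotational2_L2[OF \<E>(1)]] by (simp add: \<E>)
    \<comment> \<open>Pairing with the solution of mean \<open>v\<close>: orthogonality is used once
      for \<open>L' \<E>\<close> with \<open>K L' \<E>\<close>, and again for \<open>N \<E>\<close>
      with \<open>\<E>\<close> after symmetry of \<open>L'\<close> and the phase relation have been
      applied.\<close>
    have "v \<bullet> (M *v (K *v (M *v u))) = v \<bullet> (b *\<^sub>R (N *v u))" for v
    proof -
      have "v \<bullet> (M *v (K *v (M *v u))) = (M *v v) \<bullet> (K *v (M *v u))"
        by (simp add: M_sym)
      also have "\<dots> = (LINT x|lebesgue_on cell. (L' x *v \<E> v x) \<bullet> (K *v (L' x *v \<E> u x)))"
        using solenoidal2_orthogonal_irrotational2[OF \<E>(3) KE, of v] by (simp add: \<E> KE_mean)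
      also have "\<dots> = (LINT x|lebesgue_on cell. b * ((N *v \<E> u x) \<bullet> \<E> v x))"
        by (rule integral_cell_cong) (simp add: sym' rel' inner_commute[of "\<E> v _"])
      also have "\<dots> = b * ((N *v u) \<bullet> v)"
        using solenoidal2_orthogonal_irrotational2[OF NE \<E>(1), of v] by (simp add: \<E> NE_mean)
      finally show ?thesis
        by (simp add: inner_commute[of v])
    qed
    then have "M *v (K *v (M *v u)) = b *\<^sub>R (N *v u)"
      by (rule vector_eq_ldot[THEN iffD1, OF allI])
    then show ?thesis
      by (simp add: matrix_vector_mul_assoc matrix_mul_assoc scaleR_matrix_vector_assoc)
  qed
  then show ?thesis
    unfolding M_def K_def N_def by (simp add: matrix_eq)
qed

subsection \<open>The relation for isotropic phases\<close>

lemma kron_mult: "(P \<otimes>\<^sub>K Q) ** (P' \<otimes>\<^sub>K Q') = (P ** P') \<otimes>\<^sub>K (Q ** Q')"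
  unfolding vec_eq_iff matrix_matrix_mult_def kron_def sum_field_index
  by (simp add: sum_2 algebra_simps)

lemma kron_add_left: "(P + P') \<otimes>\<^sub>K Q = P \<otimes>\<^sub>K Q + P' \<otimes>\<^sub>K Q"
  by (simp add: kron_def vec_eq_iff algebra_simps)

lemma vec2_eq_iff: "P = Q \<longleftrightarrow> P $ 1 $ 1 = Q $ 1 $ 1 \<and> P $ 1 $ 2 = Q $ 1 $ 2 \<and>
    P $ 2 $ 1 = Q $ 2 $ 1 \<and> P $ 2 $ 2 = Q $ 2 $ 2" for P Q :: "real ^ 2 ^ 2"
  by (auto simp: vec_eq_iff forall_2)

lemma R_perp_nth: "R_perp $ 1 $ 1 = 0" "R_perp $ 1 $ 2 = -1" "R_perp $ 2 $ 1 = 1" "R_perp $ 2 $ 2 = 0"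
  by (simp_all add: R_perp_def)

lemma mat2_mult_nth: "(P ** Q) $ i $ j = P $ i $ 1 * Q $ 1 $ j + P $ i $ 2 * Q $ 2 $ j"
  for P Q :: "real ^ 2 ^ 2"
  by (simp add: matrix_matrix_mult_def sum_2)

lemma R_perp_cube: "R_perp ** R_perp ** R_perp = - R_perp"
  by (simp add: vec2_eq_iff mat2_mult_nth R_perp_nth)

lemma matrix_add_rdistrib: "(A + B) ** C = A ** C + B ** C"
  for A B :: "'a::semiring_1 ^ 'n ^ 'm"
  by (simp add: matrix_matrix_mult_def vec_eq_iff distrib_right sum.distrib)

text \<open>Brings the conjugated tensor to the form with right factor \<open>R_perp\<close>, to
  which the duality lemmas apply.\<close>

lemma R_perp_kron_conjugate:
  "T_perp ** (Z \<otimes>\<^sub>K R_perp) ** T_perp = (- (R_perp ** Z ** R_perp)) \<otimes>\<^sub>K R_perp"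
  unfolding T_perp_def kron_mult R_perp_cube by (simp add: kron_def vec_eq_iff)

text \<open>For symmetric \<open>Z\<close> the matrix \<open>- (R_perp ** Z ** R_perp)\<close> is
  its adjugate \<open>W\<close>, and \<open>orth\<close> says that \<open>\<sigma> ** W\<close> has
  trace zero. This removes the terms that are not multiples of
  \<open>Z \<otimes>\<^sub>K R_perp\<close>.\<close>

lemma isotropic_kron_relation:
  fixes \<sigma> Z :: "real ^ 2 ^ 2"
  assumes \<sigma>: "transpose \<sigma> = \<sigma>" and Z: "transpose Z = Z"
    and orth: "\<sigma> $ 1 $ 1 * Z $ 2 $ 2 - 2 * \<sigma> $ 1 $ 2 * Z $ 1 $ 2 + \<sigma> $ 2 $ 2 * Z $ 1 $ 1 = 0"
  shows "isotropic \<sigma> \<rho> ** (T_perp ** (Z \<otimes>\<^sub>K R_perp) ** T_perp) ** isotropic \<sigma> \<rho> =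
    (\<rho>\<^sup>2 - det \<sigma>) *\<^sub>R (Z \<otimes>\<^sub>K R_perp)"
proof -
  have sym: "\<sigma> $ 2 $ 1 = \<sigma> $ 1 $ 2" "Z $ 2 $ 1 = Z $ 1 $ 2"
    using arg_cong[OF \<sigma>, of "\<lambda>X. X $ 1 $ 2"] arg_cong[OF Z, of "\<lambda>X. X $ 1 $ 2"]
    by (simp_all add: transpose_def)
  define W where "W = - (R_perp ** Z ** R_perp)"
  have W: "W $ 1 $ 1 = Z $ 2 $ 2" "W $ 1 $ 2 = - Z $ 1 $ 2" "W $ 2 $ 1 = - Z $ 1 $ 2" "W $ 2 $ 2 = Z $ 1 $ 1"
    by (simp_all add: W_def mat2_mult_nth R_perp_nth sym)
  define t where "t = \<sigma> $ 1 $ 1 * Z $ 2 $ 2 - 2 * \<sigma> $ 1 $ 2 * Z $ 1 $ 2 + \<sigma> $ 2 $ 2 * Z $ 1 $ 1"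
  \<comment> \<open>By Cayley-Hamilton, \<open>X ** W ** X\<close> equals \<open>X\<close> times the
    trace of \<open>X ** W\<close>, minus \<open>det X\<close> times \<open>Z\<close>. For
    \<open>X = \<sigma> + s *\<^sub>R R_perp\<close>, the coefficients of 1, \<open>s\<close> and
    \<open>s\<^sup>2\<close> are this identity, the next one and fact 3, since a symmetric matrix
    times a skew one has trace zero.\<close>
  have "\<sigma> ** W ** \<sigma> = t *\<^sub>R \<sigma> - det \<sigma> *\<^sub>R Z"
    by (simp add: vec2_eq_iff mat2_mult_nth W sym det_2 t_def algebra_simps)
  moreover have "\<sigma> ** W ** R_perp + R_perp ** W ** \<sigma> = t *\<^sub>R R_perp"
    by (simp add: vec2_eq_iff mat2_mult_nth W sym R_perp_nth t_def algebra_simps)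
  moreover have "t = 0"
    using orth by (simp add: t_def)
  ultimately have 1: "\<sigma> ** W ** \<sigma> = - det \<sigma> *\<^sub>R Z" and 2: "\<sigma> ** W ** R_perp = - (R_perp ** W ** \<sigma>)"
    by (simp_all add: eq_neg_iff_add_eq_0)
  have 3: "R_perp ** W ** R_perp = - Z"
    by (simp add: vec2_eq_iff mat2_mult_nth W sym R_perp_nth)
  have "isotropic \<sigma> \<rho> ** (W \<otimes>\<^sub>K R_perp) ** isotropic \<sigma> \<rho> =
      (\<sigma> ** W ** \<sigma>) \<otimes>\<^sub>K R_perp +
      \<rho> *\<^sub>R ((\<sigma> ** W ** R_perp + R_perp ** W ** \<sigma>) \<otimes>\<^sub>K (R_perp ** R_perp)) +
      \<rho>\<^sup>2 *\<^sub>R ((R_perp ** W ** R_perp) \<otimes>\<^sub>K (R_perp ** R_perp ** R_perp))"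
    by (simp add: isotropic_def T_perp_def matrix_add_ldistrib matrix_add_rdistrib kron_mult
        scalar_matrix_assoc[symmetric] matrix_scalar_ac kron_add_left scaleR_add_right power2_eq_square)
  also have "\<dots> = (\<rho>\<^sup>2 - det \<sigma>) *\<^sub>R (Z \<otimes>\<^sub>K R_perp)"
    unfolding 1 2 3 R_perp_cube by (simp add: kron_def vec_eq_iff algebra_simps)
  finally show ?thesis
    unfolding R_perp_kron_conjugate W_def .
qed

lemma transpose_isotropic:
  assumes "transpose \<sigma> = \<sigma>"
  shows "transpose (isotropic \<sigma> r) = isotropic \<sigma> r"
proof -
  have \<sigma>: "\<sigma> $ j $ i = \<sigma> $ i $ j" for i j
    using arg_cong[OF assms, of "\<lambda>X. X $ i $ j"] by (simp add: transpose_def)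
  have T: "T_perp $ q $ p = T_perp $ p $ q" for p q
    using arg_cong[OF transpose_T_perp, of "\<lambda>X. X $ p $ q"] by (simp add: transpose_def)
  have "transpose (isotropic \<sigma> r) $ p $ q = isotropic \<sigma> r $ p $ q" for p q
    using \<sigma>[of "fst p" "fst q"] T[of p q]
    by (simp add: isotropic_def kron_def mat_def transpose_def)
  then show ?thesis
    unfolding vec_eq_iff by blast
qed

theorem mainTheorem12:
  fixes \<sigma>\<^sub>1 \<sigma>\<^sub>2 S\<^sub>1 S\<^sub>2 Z\<^sub>0 :: "real ^ 2 ^ 2"
    and r\<^sub>1 r\<^sub>2 lam\<^sub>1 lam\<^sub>2 \<Delta>\<^sub>r A B :: real
    and A\<^sub>1 A\<^sub>2 :: "(real ^ 2) set"
    and L_eff :: tensor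
  assumes "sym_pos_def \<sigma>\<^sub>1" and "sym_pos_def \<sigma>\<^sub>2"
    and "r\<^sub>1\<^sup>2 < det \<sigma>\<^sub>1" and "r\<^sub>2\<^sup>2 < det \<sigma>\<^sub>2"
    and "\<nexists>c. \<sigma>\<^sub>1 = c *\<^sub>R \<sigma>\<^sub>2" and "\<nexists>c. \<sigma>\<^sub>2 = c *\<^sub>R \<sigma>\<^sub>1"
    and "\<bar>r\<^sub>1 - r\<^sub>2\<bar> > \<bar>sqrt (det \<sigma>\<^sub>1) - sqrt (det \<sigma>\<^sub>2)\<bar>"
    and "A\<^sub>1 \<in> sets lebesgue" and "A\<^sub>2 \<in> sets lebesgue"
    and "A\<^sub>1 \<union> A\<^sub>2 = cell" and "A\<^sub>1 \<inter> A\<^sub>2 = {}"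
    and "two_phase A\<^sub>1 (isotropic \<sigma>\<^sub>1 r\<^sub>1) (isotropic \<sigma>\<^sub>2 r\<^sub>2) has_effective_tensor L_eff"
    and "{t. det (\<sigma>\<^sub>2 - t *\<^sub>R \<sigma>\<^sub>1) = 0} = {lam\<^sub>1, lam\<^sub>2}"
    and "\<Delta>\<^sub>r = r\<^sub>2 - r\<^sub>1"
    and "S\<^sub>1 = (1 / (lam\<^sub>2 - lam\<^sub>1)) *\<^sub>R (\<sigma>\<^sub>2 - lam\<^sub>1 *\<^sub>R \<sigma>\<^sub>1)"
    and "S\<^sub>2 = (1 / (lam\<^sub>1 - lam\<^sub>2)) *\<^sub>R (\<sigma>\<^sub>2 - lam\<^sub>2 *\<^sub>R \<sigma>\<^sub>1)"
    and "Z\<^sub>0 = S\<^sub>2 ** R_perp ** S\<^sub>1 - S\<^sub>1 ** R_perp ** S\<^sub>2"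
    and "A = (det \<sigma>\<^sub>2 - det \<sigma>\<^sub>1 + r\<^sub>1\<^sup>2 - r\<^sub>2\<^sup>2) / (2 * \<Delta>\<^sub>r)"
    and "B = (\<Delta>\<^sub>r\<^sup>2 - (sqrt (det \<sigma>\<^sub>1) - sqrt (det \<sigma>\<^sub>2))\<^sup>2) *
             ((sqrt (det \<sigma>\<^sub>1) + sqrt (det \<sigma>\<^sub>2))\<^sup>2 - \<Delta>\<^sub>r\<^sup>2) / (4 * \<Delta>\<^sub>r\<^sup>2)"
  shows "(L_eff + A *\<^sub>R T_perp) ** (T_perp ** (Z\<^sub>0 \<otimes>\<^sub>K R_perp) ** T_perp) ** (L_eff + A *\<^sub>R T_perp)
           + B *\<^sub>R (Z\<^sub>0 \<otimes>\<^sub>K R_perp) = 0"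
proof -
  have sym: "transpose \<sigma>\<^sub>1 = \<sigma>\<^sub>1" "transpose \<sigma>\<^sub>2 = \<sigma>\<^sub>2"
    using assms(1,2) by (simp_all add: sym_pos_def_def)
  have sym': "\<sigma>\<^sub>1 $ 2 $ 1 = \<sigma>\<^sub>1 $ 1 $ 2" "\<sigma>\<^sub>2 $ 2 $ 1 = \<sigma>\<^sub>2 $ 1 $ 2"
    using arg_cong[OF sym(1), of "\<lambda>X. X $ 1 $ 2"] arg_cong[OF sym(2), of "\<lambda>X. X $ 1 $ 2"]
    by (simp_all add: transpose_def)
  have det: "0 \<le> det \<sigma>\<^sub>1" "0 \<le> det \<sigma>\<^sub>2"
    using assms(3,4) zero_le_power2[of r\<^sub>1] zero_le_power2[of r\<^sub>2] by linarith+
  have \<Delta>: "\<Delta>\<^sub>r \<noteq> 0"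
    using assms(7,14) by auto
  \<comment> \<open>Only squares of the square roots survive in the product, which makes
    \<open>B\<close> rational in the determinants.\<close>
  have B: "B = (2 * \<Delta>\<^sub>r\<^sup>2 * (det \<sigma>\<^sub>1 + det \<sigma>\<^sub>2) - \<Delta>\<^sub>r\<^sup>2 * \<Delta>\<^sub>r\<^sup>2 - (det \<sigma>\<^sub>1 - det \<sigma>\<^sub>2)\<^sup>2) / (4 * \<Delta>\<^sub>r\<^sup>2)"
  proof -
    have "(d - (x - y)\<^sup>2) * ((x + y)\<^sup>2 - d) = 2 * d * (x\<^sup>2 + y\<^sup>2) - d * d - (x\<^sup>2 - y\<^sup>2)\<^sup>2"
      for d x y :: real
      by (simp add: power2_eq_square algebra_simps)
    from this[of "\<Delta>\<^sub>r\<^sup>2" "sqrt (det \<sigma>\<^sub>1)" "sqrt (det \<sigma>\<^sub>2)"] show ?thesis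
      using det by (simp add: assms(19))
  qed
  \<comment> \<open>\<open>A\<close> solves the linear equation that makes the two left-hand sides
    equal, and \<open>- B\<close> is their common value. The proof clears denominators by
    multiplying with \<open>4 * \<Delta>\<^sub>r\<^sup>2\<close>.\<close>
  have B1: "(r\<^sub>1 + A)\<^sup>2 - det \<sigma>\<^sub>1 = - B" and B2: "(r\<^sub>2 + A)\<^sup>2 - det \<sigma>\<^sub>2 = - B"
  proof -
    have A: "2 * \<Delta>\<^sub>r * (r\<^sub>1 + A) = det \<sigma>\<^sub>2 - det \<sigma>\<^sub>1 - \<Delta>\<^sub>r\<^sup>2" "2 * \<Delta>\<^sub>r * (r\<^sub>2 + A) = det \<sigma>\<^sub>2 - det \<sigma>\<^sub>1 + \<Delta>\<^sub>r\<^sup>2"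
      using \<Delta> by (simp_all add: assms(18) distrib_left) (simp_all add: assms(14) power2_eq_square algebra_simps)
    have BB: "4 * \<Delta>\<^sub>r\<^sup>2 * B = 2 * \<Delta>\<^sub>r\<^sup>2 * (det \<sigma>\<^sub>1 + det \<sigma>\<^sub>2) - \<Delta>\<^sub>r\<^sup>2 * \<Delta>\<^sub>r\<^sup>2 - (det \<sigma>\<^sub>1 - det \<sigma>\<^sub>2)\<^sup>2"
      using \<Delta> by (simp add: B)
    have f: "4 * \<Delta>\<^sub>r\<^sup>2 * ((r\<^sub>1 + A)\<^sup>2 - det \<sigma>\<^sub>1) = (2 * \<Delta>\<^sub>r * (r\<^sub>1 + A))\<^sup>2 - 4 * \<Delta>\<^sub>r\<^sup>2 * det \<sigma>\<^sub>1"
      "4 * \<Delta>\<^sub>r\<^sup>2 * ((r\<^sub>2 + A)\<^sup>2 - det \<sigma>\<^sub>2) = (2 * \<Delta>\<^sub>r * (r\<^sub>2 + A))\<^sup>2 - 4 * \<Delta>\<^sub>r\<^sup>2 * det \<sigma>\<^sub>2"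
      by (simp_all add: power_mult_distrib right_diff_distrib)
    have g: "(2 * \<Delta>\<^sub>r * (r\<^sub>1 + A))\<^sup>2 - 4 * \<Delta>\<^sub>r\<^sup>2 * det \<sigma>\<^sub>1 = - (4 * \<Delta>\<^sub>r\<^sup>2 * B)"
      "(2 * \<Delta>\<^sub>r * (r\<^sub>2 + A))\<^sup>2 - 4 * \<Delta>\<^sub>r\<^sup>2 * det \<sigma>\<^sub>2 = - (4 * \<Delta>\<^sub>r\<^sup>2 * B)"
      unfolding A BB by (simp_all add: power2_eq_square algebra_simps)
    have nz: "4 * \<Delta>\<^sub>r\<^sup>2 \<noteq> 0"
      using \<Delta> by simp
    have "4 * \<Delta>\<^sub>r\<^sup>2 * ((r\<^sub>1 + A)\<^sup>2 - det \<sigma>\<^sub>1) = 4 * \<Delta>\<^sub>r\<^sup>2 * (- B)"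
      unfolding f(1) g(1) mult_minus_right ..
    with nz show "(r\<^sub>1 + A)\<^sup>2 - det \<sigma>\<^sub>1 = - B"
      by (simp only: mult_cancel_left simp_thms)
    have "4 * \<Delta>\<^sub>r\<^sup>2 * ((r\<^sub>2 + A)\<^sup>2 - det \<sigma>\<^sub>2) = 4 * \<Delta>\<^sub>r\<^sup>2 * (- B)"
      unfolding f(2) g(2) mult_minus_right ..
    with nz show "(r\<^sub>2 + A)\<^sup>2 - det \<sigma>\<^sub>2 = - B"
      by (simp only: mult_cancel_left simp_thms)
  qed
  \<comment> \<open>The two normalising factors of \<open>S\<^sub>1\<close> and
    \<open>S\<^sub>2\<close>, times the factor \<open>lam\<^sub>2 - lam\<^sub>1\<close> left by the
    bilinear expansion, in which the terms pairing a phase with itself cancel.\<close>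
  define k where "k = (1 / (lam\<^sub>2 - lam\<^sub>1)) * (1 / (lam\<^sub>1 - lam\<^sub>2)) * (lam\<^sub>2 - lam\<^sub>1)"
  have Z: "Z\<^sub>0 = k *\<^sub>R (\<sigma>\<^sub>2 ** R_perp ** \<sigma>\<^sub>1 - \<sigma>\<^sub>1 ** R_perp ** \<sigma>\<^sub>2)"
  proof -
    have "Y ** R_perp ** X - X ** R_perp ** Y =
        (u * w * (lam\<^sub>2 - lam\<^sub>1)) *\<^sub>R (\<sigma>\<^sub>2 ** R_perp ** \<sigma>\<^sub>1 - \<sigma>\<^sub>1 ** R_perp ** \<sigma>\<^sub>2)"
      if "X = u *\<^sub>R (\<sigma>\<^sub>2 - lam\<^sub>1 *\<^sub>R \<sigma>\<^sub>1)" "Y = w *\<^sub>R (\<sigma>\<^sub>2 - lam\<^sub>2 *\<^sub>R \<sigma>\<^sub>1)" for X Y u w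
      unfolding that by (simp add: vec2_eq_iff mat2_mult_nth R_perp_nth sym' algebra_simps)
    from this[OF assms(15,16)] show ?thesis
      unfolding assms(17) k_def .
  qed
  \<comment> \<open>Transposition swaps the two products and changes their signs,
    \<open>R_perp\<close> being skew.\<close>
  have Z_sym: "transpose Z\<^sub>0 = Z\<^sub>0"
    unfolding Z by (simp add: vec2_eq_iff transpose_def mat2_mult_nth R_perp_nth sym' algebra_simps)
  \<comment> \<open>These are the traces of \<open>Z\<^sub>0\<close> against the adjugates of the
    phases. Cyclicity reduces them to traces of a symmetric matrix times \<open>R_perp\<close>,
    which vanish; the code verifies this by components.\<close>
  have orth: "\<sigma>\<^sub>1 $ 1 $ 1 * Z\<^sub>0 $ 2 $ 2 - 2 * \<sigma>\<^sub>1 $ 1 $ 2 * Z\<^sub>0 $ 1 $ 2 + \<sigma>\<^sub>1 $ 2 $ 2 * Z\<^sub>0 $ 1 $ 1 = 0"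
    "\<sigma>\<^sub>2 $ 1 $ 1 * Z\<^sub>0 $ 2 $ 2 - 2 * \<sigma>\<^sub>2 $ 1 $ 2 * Z\<^sub>0 $ 1 $ 2 + \<sigma>\<^sub>2 $ 2 $ 2 * Z\<^sub>0 $ 1 $ 1 = 0"
    unfolding Z by (simp_all add: mat2_mult_nth R_perp_nth sym' algebra_simps)
  note rel = isotropic_kron_relation[OF sym(1) Z_sym orth(1), of "r\<^sub>1 + A", unfolded B1]
    isotropic_kron_relation[OF sym(2) Z_sym orth(2), of "r\<^sub>2 + A", unfolded B2]
  \<comment> \<open>Adding \<open>A *\<^sub>R T_perp\<close> keeps a phase isotropic, so
    \<open>rel\<close> covers the shifted phases.\<close>
  have shift: "isotropic \<sigma> r + A *\<^sub>R T_perp = isotropic \<sigma> (r + A)" for \<sigma> r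
    by (simp add: isotropic_def scaleR_add_left)
  have "(L_eff + A *\<^sub>R T_perp) ** (T_perp ** (Z\<^sub>0 \<otimes>\<^sub>K R_perp) ** T_perp) ** (L_eff + A *\<^sub>R T_perp) =
      (- B) *\<^sub>R (Z\<^sub>0 \<otimes>\<^sub>K R_perp)"
    unfolding R_perp_kron_conjugate
  proof (rule effective_tensor_kron_relation[OF assms(12)])
    fix x
    show "transpose (two_phase A\<^sub>1 (isotropic \<sigma>\<^sub>1 r\<^sub>1) (isotropic \<sigma>\<^sub>2 r\<^sub>2) x) =
        two_phase A\<^sub>1 (isotropic \<sigma>\<^sub>1 r\<^sub>1) (isotropic \<sigma>\<^sub>2 r\<^sub>2) x"
      by (simp add: two_phase_def transpose_isotropic sym)
    show "(two_phase A\<^sub>1 (isotropic \<sigma>\<^sub>1 r\<^sub>1) (isotropic \<sigma>\<^sub>2 r\<^sub>2) x + A *\<^sub>R T_perp) **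
        ((- (R_perp ** Z\<^sub>0 ** R_perp)) \<otimes>\<^sub>K R_perp) **
        (two_phase A\<^sub>1 (isotropic \<sigma>\<^sub>1 r\<^sub>1) (isotropic \<sigma>\<^sub>2 r\<^sub>2) x + A *\<^sub>R T_perp) =
        (- B) *\<^sub>R (Z\<^sub>0 \<otimes>\<^sub>K R_perp)"
      using rel unfolding R_perp_kron_conjugate two_phase_def by (simp add: shift)
  qed
  then show ?thesis
    by simp
qed

end
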